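(* Let $X$ be an affine normal toric variety over $\mathbb{K}$ with an effective action of a torus $\mathbb{T}$ and let $\sigma$ be the corresponding cone. Let $e$ be a Demazure root corresponding to an extremal ray $\rho$ of the cone $\sigma$. Then the LND $\delta_e$ of $\mathbb{K}[X]$ is maximal if and only if $\langle e,v'\rangle\ne0$ for every extremal ray $\rho'\in\mathcal{E}(\rho)$, where $v'$ denotes the primitive lattice vector on $\rho'$.
   Context: $\mathbb{K}$ is an algebraically closed field of characteristic zero. A toric variety is an irreducible variety with a regular action of a torus $\mathbb{T}$ having an open orbit. Let $N$ be the lattice of one-parameter subgroups of $\mathbb{T}$, $M=\mathrm{Hom}(N,\mathbb{Z})$ the character lattice, $\langle\cdot,\cdot\rangle\colon M\times N\to\mathbb{Z}$ the natural pairing, extended to $M_\mathbb{Q}\times N_\mathbb{Q}$. The affine normal toric variety $X$ corresponds to a pointed rational polyhedral cone $\sigma\subset N_\mathbb{Q}$ with $\mathbb{K}[X]=\bigoplus_{m\in\sigma^\vee\cap M}\mathbb{K}\chi^m$, where $\sigma^\vee=\{m\in M_\mathbb{Q}:\langle m,v\rangle\ge0\ \forall v\in\sigma\}$ and $\chi^m$ is the character corresponding to $m$. Let $\rho_1,\dots,\rho_k$ be the extremal rays of $\sigma$ and $v_1,\dots,v_k\in N$ the primitive vectors on them. A Demazure root corresponding to $\rho_i$ is $e\in M$ with $\langle e,v_i\rangle=-1$ and $\langle e,v_j\rangle\ge0$ for all $j\ne i$; it defines the $\mathbb{T}$-homogeneous locally nilpotent derivation (LND) $\delta_e(\chi^m)=\langle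 m,v_i\rangle\chi^{m+e}$. For an extremal ray $\rho$, $\mathcal{E}(\rho)$ is the set of all extremal rays that lie together with $\rho$ on a common two-dimensional face of $\sigma$. Two LNDs are equivalent if their kernels coincide; a nonzero LND is maximal if every nonzero LND of $\mathbb{K}[X]$ commuting with it is equivalent to it. *)

theory Defs
  imports "HOL-Analysis.Analysis" "HOL-Library.Poly_Mapping"
    "HOL-Computational_Algebra.Polynomial"
begin

text \<open>
  The lattices $N$ and $M = \mathrm{Hom}(N, \mathbb{Z})$ of rank \<open>n\<close> are both coordinatised as
  \<^typ>\<open>int ^ 'n\<close>, in dual bases, and their rational extensions as \<^typ>\<open>rat ^ 'n\<close>.
\<close>

definition pairing :: "'a::comm_semiring_1 ^ 'n \<Rightarrow> 'a ^ 'n \<Rightarrow> 'a" where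
  "pairing m v = (\<Sum>i\<in>UNIV. m $ i * v $ i)"

definition rat_vec :: "int ^ 'n \<Rightarrow> rat ^ 'n" where
  "rat_vec v = (\<chi> i. of_int (v $ i))"


subsection \<open>Cones, faces and rays\<close>

definition cone_generated :: "(rat ^ 'n) set \<Rightarrow> (rat ^ 'n) set" where
  "cone_generated S = {\<Sum>s\<in>S. c s *s s | c. \<forall>s\<in>S. 0 \<le> c s}"

definition polyhedral_cone :: "(rat ^ 'n) set \<Rightarrow> bool" where
  "polyhedral_cone \<sigma> \<longleftrightarrow> (\<exists>S. finite S \<and> \<sigma> = cone_generated S)"

definition pointed_cone :: "(rat ^ 'n) set \<Rightarrow> bool" where
  "pointed_cone \<sigma> \<longleftrightarrow> (\<forall>v\<in>\<sigma>. - v \<in> \<sigma> \<longrightarrow> v = 0)"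

definition dual_cone :: "(rat ^ 'n) set \<Rightarrow> (rat ^ 'n) set" where
  "dual_cone \<sigma> = {m. \<forall>v\<in>\<sigma>. 0 \<le> pairing m v}"

text \<open>The choice \<open>u = 0\<close> makes \<open>\<sigma>\<close> a face of itself.\<close>

definition cone_face :: "(rat ^ 'n) set \<Rightarrow> (rat ^ 'n) set \<Rightarrow> bool" where
  "cone_face \<tau> \<sigma> \<longleftrightarrow> (\<exists>u\<in>dual_cone \<sigma>. \<tau> = {v\<in>\<sigma>. pairing u v = 0})"

text \<open>\<^term>\<open>vec.dim \<tau>\<close> is the dimension of the \<open>\<rat>\<close>-linear span of \<open>\<tau>\<close>.\<close>

definition extremal_rays :: "(rat ^ 'n) set \<Rightarrow> (rat ^ 'n) set set" where
  "extremal_rays \<sigma> = {\<rho>. cone_face \<rho> \<sigma> \<and> vec.dim \<rho> = 1}"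

definition adjacent_rays :: "(rat ^ 'n) set \<Rightarrow> (rat ^ 'n) set \<Rightarrow> (rat ^ 'n) set set" where
  "adjacent_rays \<sigma> \<rho> = {\<rho>'\<in>extremal_rays \<sigma>. \<rho>' \<noteq> \<rho> \<and>
     (\<exists>\<tau>. cone_face \<tau> \<sigma> \<and> vec.dim \<tau> = 2 \<and> \<rho> \<subseteq> \<tau> \<and> \<rho>' \<subseteq> \<tau>)}"

definition primitive_vector :: "int ^ 'n \<Rightarrow> bool" where
  "primitive_vector v \<longleftrightarrow> v \<noteq> 0 \<and> (\<forall>k w. v = k *s w \<longrightarrow> \<bar>k\<bar> = 1)"

definition ray_vector :: "(rat ^ 'n) set \<Rightarrow> int ^ 'n" where
  "ray_vector \<rho> = (THE v. primitive_vector v \<and> rat_vec v \<in> \<rho>)"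

text \<open>The definite description in \<open>ray_vector\<close> is well defined on extremal rays:\<close>

lemma ex1_ray_vector:
  fixes \<sigma> \<rho> :: "(rat ^ 'n) set"
  assumes poly: "polyhedral_cone \<sigma>" and pt: "pointed_cone \<sigma>" and ray: "\<rho> \<in> extremal_rays \<sigma>"
  shows "\<exists>!v. primitive_vector v \<and> rat_vec v \<in> \<rho>"
proof -
  obtain u where \<rho>: "\<rho> = {v\<in>\<sigma>. pairing u v = 0}" and dim: "vec.dim \<rho> = 1"
    using ray by (auto simp: extremal_rays_def cone_face_def)
  have scale_\<sigma>: "c *s x \<in> \<sigma>" if x: "x \<in> \<sigma>" and c: "0 \<le> c" for c x
  proof -
    obtain S where S: "\<sigma> = cone_generated S"
      using poly by (auto simp: polyhedral_cone_def)
    obtain d where d: "x = (\<Sum>s\<in>S. d s *s s)" "\<forall>s\<in>S. 0 \<le> d s"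
      using x S by (auto simp: cone_generated_def)
    have "c *s x = (\<Sum>s\<in>S. (c * d s) *s s)"
      by (simp add: d(1) vec.scale_sum_right)
    moreover have "\<forall>s\<in>S. 0 \<le> c * d s" using d(2) c by simp
    ultimately show ?thesis unfolding S cone_generated_def
      by (intro CollectI exI[of _ "\<lambda>s. c * d s"] conjI)
  qed
  have scale: "c *s x \<in> \<rho>" if x: "x \<in> \<rho>" and c: "0 \<le> c" for c x
  proof -
    have "pairing u (c *s x) = c * pairing u x"
      by (simp add: pairing_def sum_distrib_left mult_ac)
    then show ?thesis using that scale_\<sigma> by (auto simp: \<rho>)
  qed
  have ray_line: "\<exists>c. x = c *s y" if x: "x \<in> \<rho>" and y: "y \<in> \<rho>" "y \<noteq> 0" for x y
  proof -
    have "vec.independent {y}" using y by (simp add: vec.independent_insert)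
    then have "\<rho> \<subseteq> vec.span {y}"
      using vec.card_ge_dim_independent[of "{y}" \<rho>] y dim by simp
    then show ?thesis using x by (auto simp: vec.span_singleton)
  qed
  have "\<exists>w\<in>\<rho>. w \<noteq> 0"
  proof (rule ccontr)
    assume "\<not> (\<exists>w\<in>\<rho>. w \<noteq> 0)"
    then have "vec.dim \<rho> = 0" by auto
    then show False using dim by simp
  qed
  then obtain w where w: "w \<in> \<rho>" "w \<noteq> 0" by blast
  define d where "d = (\<Prod>i\<in>UNIV. snd (quotient_of (w $ i)))"
  have d0: "d > 0" by (auto simp: d_def quotient_of_denom_pos' intro!: prod_pos)
  have "\<exists>z. of_int z = of_int d * w $ i" for i
  proof -
    obtain a b where ab: "quotient_of (w $ i) = (a, b)" by fastforce
    have "b dvd d" using dvd_prodI[of UNIV i "\<lambda>i. snd (quotient_of (w $ i))"] ab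
      by (simp add: d_def)
    then obtain k where k: "d = b * k" by blast
    have "b > 0" using ab by (rule quotient_of_denom_pos)
    then have "of_int (k * a) = of_int d * w $ i"
      using quotient_of_div[OF ab] k by simp
    then show ?thesis by blast
  qed
  then obtain z where z: "\<And>i. of_int (z i) = of_int d * w $ i" by metis
  define w' where "w' = (\<chi> i. z i)"
  have w': "rat_vec w' = of_int d *s w"
    by (simp add: rat_vec_def w'_def vec_eq_iff z)
  have w'0: "w' \<noteq> 0"
  proof
    assume "w' = 0"
    then have "of_int d *s w = 0" using w' by (simp add: rat_vec_def vec_eq_iff)
    then show False using w d0 by simp
  qed
  define g where "g = Gcd (range (($) w'))"
  have g0: "g > 0"
  proof -
    have "g \<noteq> 0" using w'0 by (auto simp: g_def Gcd_0_iff vec_eq_iff)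
    moreover have "g \<ge> 0" by (simp add: g_def)
    ultimately show ?thesis by simp
  qed
  have gdvd: "g dvd w' $ i" for i by (simp add: g_def)
  define v where "v = (\<chi> i. w' $ i div g)"
  have w'v: "w' = g *s v" using gdvd by (simp add: v_def vec_eq_iff)
  have "primitive_vector v"
    unfolding primitive_vector_def
  proof (intro conjI allI impI)
    show "v \<noteq> 0" using w'0 w'v by auto
    fix k x assume "v = k *s x"
    then have "g * k dvd w' $ i" for i by (simp add: w'v)
    then have "g * k dvd g" unfolding g_def by (intro Gcd_greatest) auto
    then show "\<bar>k\<bar> = 1" using g0 by simp
  qed
  moreover have "rat_vec v \<in> \<rho>"
  proof -
    have "rat_vec w' = of_int g *s rat_vec v" by (simp add: w'v rat_vec_def vec_eq_iff)
    then have "rat_vec v = (of_int d / of_int g) *s w"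
      using w' g0 by (simp add: vec_eq_iff field_simps)
    then show ?thesis using scale w(1) d0 g0 by simp
  qed
  moreover have "v1 = v2" if v12: "primitive_vector v1 \<and> rat_vec v1 \<in> \<rho>"
    "primitive_vector v2 \<and> rat_vec v2 \<in> \<rho>" for v1 v2
  proof -
    have v20: "rat_vec v2 \<noteq> 0" using that(2)
      by (auto simp: primitive_vector_def rat_vec_def vec_eq_iff)
    then obtain c where c: "rat_vec v1 = c *s rat_vec v2" using ray_line v12 by blast
    obtain p q where pq: "quotient_of c = (p, q)" by fastforce
    have q0: "q > 0" using pq by (rule quotient_of_denom_pos)
    have cop: "coprime p q" using pq by (rule quotient_of_coprime)
    have eq: "q * v1 $ i = p * v2 $ i" for i
    proof -
      have "of_int (v1 $ i) = (of_int p / of_int q) * (of_int (v2 $ i) :: rat)"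
        using c quotient_of_div[OF pq] by (simp add: rat_vec_def vec_eq_iff)
      then have "(of_int (q * v1 $ i) :: rat) = of_int (p * v2 $ i)"
        using q0 by (simp add: field_simps)
      then show ?thesis by (simp only: of_int_eq_iff)
    qed
    have prim: "\<bar>k\<bar> = 1" if "primitive_vector x" "\<And>i. k dvd x $ i" for k and x :: "int ^ 'n"
    proof -
      have "x = k *s (\<chi> i. x $ i div k)" using that(2) by (simp add: vec_eq_iff)
      then show ?thesis using that(1) unfolding primitive_vector_def by blast
    qed
    have "q dvd v2 $ i" for i
      using eq[of i] cop by (metis coprime_commute coprime_dvd_mult_right_iff dvd_triv_left)
    then have q1: "q = 1" using prim[of v2 q] that q0 by simp
    have "p dvd v1 $ i" for i using eq[of i] q1 by simp
    then have "\<bar>p\<bar> = 1" using prim[of v1 p] that by simp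
    then consider "p = 1" | "p = -1" by linarith
    then show ?thesis
    proof cases
      case 1
      then show ?thesis using eq q1 by (simp add: vec_eq_iff)
    next
      case 2
      then have "rat_vec v1 = - rat_vec v2" using eq q1 by (simp add: vec_eq_iff rat_vec_def)
      then have "rat_vec v2 = 0" using that pt by (auto simp: \<rho> pointed_cone_def)
      then show ?thesis using v20 by simp
    qed
  qed
  ultimately show ?thesis by blast
qed

definition demazure_root :: "(rat ^ 'n) set \<Rightarrow> (rat ^ 'n) set \<Rightarrow> int ^ 'n \<Rightarrow> bool" where
  "demazure_root \<sigma> \<rho> e \<longleftrightarrow> \<rho> \<in> extremal_rays \<sigma> \<and> pairing e (ray_vector \<rho>) = -1 \<and>
     (\<forall>\<rho>'\<in>extremal_rays \<sigma>. \<rho>' \<noteq> \<rho> \<longrightarrow> 0 \<le> pairing e (ray_vector \<rho>'))"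


subsection \<open>The coordinate algebra and its locally nilpotent derivations\<close>

text \<open>
  The group algebra of \<open>M\<close> is \<^typ>\<open>(int ^ 'n) \<Rightarrow>\<^sub>0 'k\<close> with the convolution product of
  \<^theory>\<open>HOL-Library.Poly_Mapping\<close>; the character \<open>\<chi>\<^sup>m\<close> is \<^term>\<open>Poly_Mapping.single m 1\<close>.
  The coordinate algebra of the toric variety is the subalgebra spanned by the
  characters in the dual cone.
\<close>

definition coord_ring :: "(rat ^ 'n) set \<Rightarrow> (int ^ 'n \<Rightarrow>\<^sub>0 'k::field) set" where
  "coord_ring \<sigma> = {f. \<forall>m\<in>Poly_Mapping.keys f. rat_vec m \<in> dual_cone \<sigma>}"

text \<open>
  Self-maps of a subalgebra \<open>A\<close> are represented by functions on the ambient type whose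
  values outside \<open>A\<close> are irrelevant: every notion below inspects them on \<open>A\<close> only.
\<close>

definition lnd_on :: "(int ^ 'n \<Rightarrow>\<^sub>0 'k::field) set \<Rightarrow>
    ((int ^ 'n \<Rightarrow>\<^sub>0 'k) \<Rightarrow> (int ^ 'n \<Rightarrow>\<^sub>0 'k)) \<Rightarrow> bool" where
  "lnd_on A D \<longleftrightarrow>
     (\<forall>f\<in>A. D f \<in> A) \<and>
     (\<forall>f\<in>A. \<forall>g\<in>A. D (f + g) = D f + D g) \<and>
     (\<forall>c. \<forall>f\<in>A. D (Poly_Mapping.single 0 c * f) = Poly_Mapping.single 0 c * D f) \<and>
     (\<forall>f\<in>A. \<forall>g\<in>A. D (f * g) = D f * g + f * D g) \<and>
     (\<forall>f\<in>A. \<exists>n. (D ^^ n) f = 0)"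

definition nonzero_on :: "(int ^ 'n \<Rightarrow>\<^sub>0 'k::field) set \<Rightarrow>
    ((int ^ 'n \<Rightarrow>\<^sub>0 'k) \<Rightarrow> (int ^ 'n \<Rightarrow>\<^sub>0 'k)) \<Rightarrow> bool" where
  "nonzero_on A D \<longleftrightarrow> (\<exists>f\<in>A. D f \<noteq> 0)"

definition kernel_on :: "(int ^ 'n \<Rightarrow>\<^sub>0 'k::field) set \<Rightarrow>
    ((int ^ 'n \<Rightarrow>\<^sub>0 'k) \<Rightarrow> (int ^ 'n \<Rightarrow>\<^sub>0 'k)) \<Rightarrow> (int ^ 'n \<Rightarrow>\<^sub>0 'k) set" where
  "kernel_on A D = {f\<in>A. D f = 0}"

definition commute_on :: "(int ^ 'n \<Rightarrow>\<^sub>0 'k::field) set \<Rightarrow>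
    ((int ^ 'n \<Rightarrow>\<^sub>0 'k) \<Rightarrow> (int ^ 'n \<Rightarrow>\<^sub>0 'k)) \<Rightarrow>
    ((int ^ 'n \<Rightarrow>\<^sub>0 'k) \<Rightarrow> (int ^ 'n \<Rightarrow>\<^sub>0 'k)) \<Rightarrow> bool" where
  "commute_on A D E \<longleftrightarrow> (\<forall>f\<in>A. D (E f) = E (D f))"

definition equivalent_on :: "(int ^ 'n \<Rightarrow>\<^sub>0 'k::field) set \<Rightarrow>
    ((int ^ 'n \<Rightarrow>\<^sub>0 'k) \<Rightarrow> (int ^ 'n \<Rightarrow>\<^sub>0 'k)) \<Rightarrow>
    ((int ^ 'n \<Rightarrow>\<^sub>0 'k) \<Rightarrow> (int ^ 'n \<Rightarrow>\<^sub>0 'k)) \<Rightarrow> bool" where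
  "equivalent_on A D E \<longleftrightarrow> kernel_on A D = kernel_on A E"

definition maximal_lnd :: "(int ^ 'n \<Rightarrow>\<^sub>0 'k::field) set \<Rightarrow>
    ((int ^ 'n \<Rightarrow>\<^sub>0 'k) \<Rightarrow> (int ^ 'n \<Rightarrow>\<^sub>0 'k)) \<Rightarrow> bool" where
  "maximal_lnd A D \<longleftrightarrow> lnd_on A D \<and> nonzero_on A D \<and>
     (\<forall>E. lnd_on A E \<and> nonzero_on A E \<and> commute_on A D E \<longrightarrow> equivalent_on A E D)"

text \<open>
  The linear extension of \<open>\<chi>\<^sup>m \<mapsto> \<langle>m, v\<rangle> \<chi>\<^bsup>m + e\<^esup>\<close>, where \<open>v\<close> is the primitive
  vector on \<open>\<rho>\<close>.
\<close>

definition demazure_lnd :: "(rat ^ 'n) set \<Rightarrow> int ^ 'n \<Rightarrow>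
    (int ^ 'n \<Rightarrow>\<^sub>0 'k::field) \<Rightarrow> (int ^ 'n \<Rightarrow>\<^sub>0 'k)" where
  "demazure_lnd \<rho> e f = (\<Sum>m\<in>Poly_Mapping.keys f.
     Poly_Mapping.single (m + e) (Poly_Mapping.lookup f m * of_int (pairing m (ray_vector \<rho>))))"

end

theory Submission
  imports Defs
begin

text \<open>
  Write \<open>v\<close> for the primitive vector on \<open>\<rho>\<close>, \<open>R\<close> for the set of all primitive ray vectors, and \<open>P\<close>
  for the monoid of weights, the lattice points \<open>m\<close> with \<open>\<langle>m, r\<rangle> \<ge> 0\<close> on \<open>R\<close>; the coordinate ring is its span.

  Cone geometry enters in three ways. The cone is generated by its extremal rays; each ray \<open>r\<close>
  carries an integral form vanishing on \<open>r\<close> and positive on the other rays; and two rays are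
  adjacent iff some integral form vanishes on both and is positive on all the others
  (\<open>exposed_pair\<close>). All of this comes from Gordan's alternative applied to an irredundant
  generating set. From there on the argument only sees the finite set \<open>R\<close> (locale \<open>ray_system\<close>).

  If \<open>r\<close> is adjacent to \<open>v\<close> and \<open>\<langle>e, r\<rangle> = 0\<close>, then \<open>\<delta>\<^sub>e\<close> is not maximal: there is a root \<open>e'\<close> of \<open>r\<close>
  with \<open>\<langle>e', v\<rangle> = 0\<close> (\<open>exposed_pair_root\<close>), the derivations \<open>\<delta>\<^sub>e\<close> and \<open>\<delta>\<^bsub>e'\<^esub>\<close> commute, and their
  kernels are the spans of two different facets of \<open>P\<close>.

  Conversely let \<open>D\<close> be a nonzero locally nilpotent derivation commuting with \<open>\<delta>\<^sub>e\<close>. Then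
  \<open>D \<chi>\<^sup>m = \<Sum>\<^sub>a \<omega>\<^sub>a(m) \<chi>\<^bsup>m+a\<^esup>\<close> with finitely many nonzero additive functions \<open>\<omega>\<^sub>a\<close>
  (\<open>lnd_weight_expansion\<close>), and comparing coefficients in \<open>D \<delta>\<^sub>e = \<delta>\<^sub>e D\<close> leaves two kinds of
  degrees \<open>a\<close>: either \<open>\<langle>a, v\<rangle> = -1\<close> and \<open>\<omega>\<^sub>a\<close> is a multiple of \<open>\<langle>_, v\<rangle>\<close>, or \<open>\<langle>a, v\<rangle> = 0\<close> and
  \<open>\<omega>\<^sub>a(e) = 0\<close> (\<open>commuting_degree_cases\<close>). If only the first kind occurs, then \<open>D\<close> is \<open>\<delta>\<^sub>e\<close> times
  a nonzero Laurent polynomial and the kernels agree (\<open>kernel_eq_of_proportional\<close>). Otherwise a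
  generic linear form perturbed by a large multiple of \<open>v\<close> is maximal at a single degree \<open>a\<close> of
  the second kind, so the corresponding homogeneous component of \<open>D\<close> inherits local nilpotency
  (\<open>dominant_degree_nilpotent\<close>). A homogeneous locally nilpotent derivation is a multiple of
  \<open>\<chi>\<^sup>m \<mapsto> \<langle>m, r\<rangle> \<chi>\<^bsup>m+a\<^esup>\<close> for a ray \<open>r\<close> on which \<open>a\<close> is negative, and \<open>a\<close> is nonnegative on all
  other rays (\<open>homogeneous_lnd_ray\<close>). Hence \<open>\<langle>e, r\<rangle> = 0\<close>, and a positive combination of \<open>e\<close>,
  \<open>a\<close> and an interior form of the dual cone vanishes on \<open>v\<close> and \<open>r\<close> and on no other ray vector: the two
  rays are adjacent.
\<close>

section \<open>The pairing and clearing of denominators\<close>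

lemma pairing_commute: "pairing m v = pairing v m"
  by (simp add: pairing_def mult.commute)

lemma pairing_add_left: "pairing (m + m') v = pairing m v + pairing m' v"
  by (simp add: pairing_def distrib_right sum.distrib)

lemma pairing_scale_left: "pairing (c *s m) v = c * pairing m v"
  by (simp add: pairing_def sum_distrib_left mult.assoc)

lemma pairing_zero_left [simp]: "pairing 0 v = 0"
  by (simp add: pairing_def)

lemma pairing_zero_right [simp]: "pairing m 0 = 0"
  by (simp add: pairing_def)

lemma pairing_minus_left: "pairing (- m) v = - pairing m v"
  for m v :: "'a::comm_ring_1 ^ 'n"
  by (simp add: pairing_def sum_negf)

lemma pairing_diff_left: "pairing (m - m') v = pairing m v - pairing m' v"
  for m m' v :: "'a::comm_ring_1 ^ 'n"
  by (simp add: pairing_def left_diff_distrib sum_subtractf)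

lemma pairing_add_right: "pairing m (v + v') = pairing m v + pairing m v'"
  by (simp add: pairing_def distrib_left sum.distrib)

lemma pairing_scale_right: "pairing m (c *s v) = c * pairing m v"
  by (simp add: pairing_commute[of m] pairing_scale_left)

lemma pairing_diff_right: "pairing m (v - v') = pairing m v - pairing m v'"
  for m v v' :: "'a::comm_ring_1 ^ 'n"
  by (simp add: pairing_def right_diff_distrib sum_subtractf)

lemma pairing_sum_right: "pairing m (\<Sum>i\<in>I. f i) = (\<Sum>i\<in>I. pairing m (f i))"
  by (induction I rule: infinite_finite_induct) (auto simp: pairing_add_right)

lemmas pairing_linear = pairing_add_left pairing_scale_left pairing_minus_left
  pairing_diff_left pairing_add_right pairing_scale_right pairing_diff_right

lemma pairing_self_pos:
  fixes v :: "'a::linordered_idom ^ 'n"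
  assumes "v \<noteq> 0"
  shows "0 < pairing v v"
proof -
  obtain i where "v $ i \<noteq> 0" using assms by (auto simp: vec_eq_iff)
  then show ?thesis
    unfolding pairing_def
    by (intro sum_pos2[of _ i]) (auto simp: zero_less_mult_iff)
qed

lemma pairing_rat_vec: "pairing (rat_vec m) (rat_vec v) = of_int (pairing m v)"
  by (simp add: pairing_def rat_vec_def)

lemma rat_vec_eq_0_iff [simp]: "rat_vec v = 0 \<longleftrightarrow> v = 0"
  by (simp add: rat_vec_def vec_eq_iff)

lemma clear_denominators:
  fixes x :: "rat ^ 'n"
  obtains d :: int and z where "0 < d" and "rat_vec z = of_int d *s x"
proof -
  define d where "d = (\<Prod>i\<in>UNIV. snd (quotient_of (x $ i)))"
  have "0 < d" by (auto simp: d_def quotient_of_denom_pos' intro!: prod_pos)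
  moreover have "\<exists>z. of_int z = of_int d * x $ i" for i
  proof -
    obtain p q where pq: "quotient_of (x $ i) = (p, q)" by fastforce
    have "q dvd d"
      using dvd_prodI[of UNIV i "\<lambda>i. snd (quotient_of (x $ i))"] pq by (simp add: d_def)
    then obtain k where "d = q * k" by blast
    moreover have "0 < q" using pq by (rule quotient_of_denom_pos)
    ultimately have "of_int (k * p) = of_int d * x $ i"
      using quotient_of_div[OF pq] by simp
    then show ?thesis by blast
  qed
  then obtain z where "\<And>i. of_int (z i) = of_int d * x $ i" by metis
  then have "rat_vec (\<chi> i. z i) = of_int d *s x" by (simp add: rat_vec_def vec_eq_iff)
  ultimately show ?thesis using that by blast
qed

section \<open>Gordan's theorem of the alternative\<close>

text \<open>
  The usual perturbation argument: a large multiple of a form that is positive at finitely many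
  points outweighs any other form there.
\<close>
lemma finite_mult_dominates:
  fixes f g :: "'b \<Rightarrow> 'a::linordered_field"
  assumes "finite I" and "\<And>i. i \<in> I \<Longrightarrow> 0 < f i"
  shows "\<exists>k>0. \<forall>i\<in>I. 0 < k * f i + g i"
  using assms
proof (induction I)
  case empty
  show ?case by (intro exI[of _ 1]) simp
next
  case (insert j I)
  then obtain k where k: "0 < k" "\<forall>i\<in>I. 0 < k * f i + g i" by auto
  define k' where "k' = k + \<bar>g j\<bar> / f j"
  have fj: "0 < f j" and fi: "\<And>i. i \<in> I \<Longrightarrow> 0 < f i" using insert.prems by auto
  have kk: "k \<le> k'" using fj by (simp add: k'_def)
  have "k' * f j = k * f j + \<bar>g j\<bar>" using fj by (simp add: k'_def field_simps)
  moreover have "0 < k * f j" using k(1) fj by simp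
  ultimately have "0 < k' * f j + g j" by linarith
  moreover have "0 < k' * f i + g i" if "i \<in> I" for i
  proof -
    have "k * f i \<le> k' * f i" using kk fi[OF that] by (simp add: mult_right_mono)
    then show ?thesis using k(2) that by fastforce
  qed
  ultimately show ?case using k(1) kk by (intro exI[of _ k']) auto
qed

text \<open>
  The integral analogue needs no division, because a positive integer is at least \<open>1\<close>.
\<close>
lemma finite_int_mult_dominates:
  fixes f g :: "'b \<Rightarrow> int"
  assumes "finite I" and "\<And>i. i \<in> I \<Longrightarrow> 0 < f i"
  shows "\<exists>k>0. \<forall>i\<in>I. 0 < k * f i + g i"
proof -
  define k where "k = 1 + (\<Sum>i\<in>I. \<bar>g i\<bar>)"
  have k: "0 < k" by (simp add: k_def add_pos_nonneg sum_nonneg)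
  have "0 < k * f i + g i" if i: "i \<in> I" for i
  proof -
    have "\<bar>g i\<bar> < k" using member_le_sum[OF i, of "\<lambda>i. \<bar>g i\<bar>"] assms(1) by (simp add: k_def)
    moreover have "k * 1 \<le> k * f i" using k assms(2)[OF i] by (intro mult_left_mono) auto
    ultimately show ?thesis by linarith
  qed
  with k show ?thesis by blast
qed

text \<open>
  The orthogonal projection to the complement of \<open>s\<close>. It is self-adjoint, so a form on the
  projections is the same as a form that vanishes on \<open>s\<close>.
\<close>
definition project_along :: "rat ^ 'n \<Rightarrow> rat ^ 'n \<Rightarrow> rat ^ 'n" where
  "project_along s x = x - (pairing s x / pairing s s) *s s"

lemma pairing_project_along_self: "pairing (project_along s u) s = 0" if "s \<noteq> 0"
  using pairing_self_pos[OF that] by (simp add: project_along_def pairing_linear pairing_commute)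

lemma project_along_self: "project_along s s = 0" if "s \<noteq> 0"
  using pairing_self_pos[OF that] by (simp add: project_along_def)

lemma pairing_project_along:
  "pairing (project_along s u) x = pairing u (project_along s x)"
  by (simp add: project_along_def pairing_linear pairing_commute)

lemma sum_project_along_eq_0:
  assumes "(\<Sum>i\<in>I. c i *s project_along s (t i)) = 0"
  obtains a where "(\<Sum>i\<in>I. c i *s t i) = a *s s"
proof -
  have "(\<Sum>i\<in>I. c i *s t i) = (\<Sum>i\<in>I. c i *s project_along s (t i))
      + (\<Sum>i\<in>I. (c i * (pairing s (t i) / pairing s s)) *s s)"
    by (simp add: project_along_def sum.distrib[symmetric] vec.scale_right_diff_distrib)
  then have "(\<Sum>i\<in>I. c i *s t i) = (\<Sum>i\<in>I. c i * (pairing s (t i) / pairing s s)) *s s"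
    using assms by (simp add: vec.scale_sum_left)
  then show ?thesis using that by blast
qed

text \<open>
  Gordan's theorem of the alternative over \<open>\<rat>\<close>, by induction on the number of vectors. A new
  vector \<open>s\<close> either lies in the cone of the old ones, and then every form positive on these is
  positive on \<open>s\<close>, or the projections of the old vectors along \<open>s\<close> are still free of
  nontrivial relations; a form positive on the projections is pulled back to one that vanishes on
  \<open>s\<close> and is then tilted slightly towards \<open>s\<close>.
\<close>
lemma gordan_alternative:
  fixes t :: "'b \<Rightarrow> rat ^ 'n"
  assumes "finite I"
    and "\<And>c. (\<forall>i\<in>I. 0 \<le> c i) \<Longrightarrow> (\<Sum>i\<in>I. c i *s t i) = 0 \<Longrightarrow> \<forall>i\<in>I. c i = 0"
  shows "\<exists>u. \<forall>i\<in>I. 0 < pairing u (t i)"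
  using assms
proof (induction I arbitrary: t)
  case empty
  then show ?case by simp
next
  case (insert j I)
  have rel: "\<forall>i\<in>insert j I. c i = 0"
    if "\<forall>i\<in>insert j I. 0 \<le> c i" "c j *s t j + (\<Sum>i\<in>I. c i *s t i) = 0" for c
    using insert.prems[of c] that insert.hyps by simp
  define s where "s = t j"
  have "s \<noteq> 0"
  proof
    assume "s = 0"
    define c :: "'b \<Rightarrow> rat" where "c i = (if i = j then 1 else 0)" for i
    have c_nonneg: "\<forall>i\<in>insert j I. 0 \<le> c i" by (simp add: c_def)
    have "(\<Sum>i\<in>I. c i *s t i) = 0"
      using insert.hyps by (intro sum.neutral) (auto simp: c_def)
    then have "c j *s t j + (\<Sum>i\<in>I. c i *s t i) = 0" using \<open>s = 0\<close> by (simp add: s_def)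
    then have "c j = 0" using rel[of c] c_nonneg by blast
    then show False by (simp add: c_def)
  qed
  then have ss: "0 < pairing s s" by (rule pairing_self_pos)
  have relI: "\<forall>i\<in>I. c i = 0" if c: "\<forall>i\<in>I. 0 \<le> c i" "a \<ge> 0" "(\<Sum>i\<in>I. c i *s t i) = - (a *s s)" for c a
  proof -
    have "(\<Sum>i\<in>I. (c(j := a)) i *s t i) = (\<Sum>i\<in>I. c i *s t i)"
      using insert.hyps by (intro sum.cong) auto
    then have "\<forall>i\<in>insert j I. (c(j := a)) i = 0"
      using rel[of "c(j := a)"] c by (simp add: s_def)
    then show ?thesis using insert.hyps by (metis fun_upd_other insertCI)
  qed
  show ?case
  proof (cases "\<exists>c a. (\<forall>i\<in>I. 0 \<le> c i) \<and> (\<exists>i\<in>I. c i \<noteq> 0) \<and> (\<Sum>i\<in>I. c i *s t i) = a *s s")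
    case True
    then obtain c a where c: "\<forall>i\<in>I. 0 \<le> c i" "\<exists>i\<in>I. c i \<noteq> 0" "(\<Sum>i\<in>I. c i *s t i) = a *s s"
      by blast
    have a: "a > 0"
    proof (rule ccontr)
      assume "\<not> a > 0"
      then show False using relI[of c "- a"] c by auto
    qed
    have "\<exists>u. \<forall>i\<in>I. 0 < pairing u (t i)"
      using relI[of _ 0] by (intro insert.IH) auto
    then obtain u where u: "\<forall>i\<in>I. 0 < pairing u (t i)" by blast
    have "0 < (\<Sum>i\<in>I. c i * pairing u (t i))"
    proof -
      obtain i where "i \<in> I" "c i \<noteq> 0" using c(2) by blast
      then show ?thesis
        using c(1) u insert.hyps by (intro sum_pos2[of _ i]) (auto simp: less_le)
    qed
    also have "\<dots> = a * pairing u s"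
      using arg_cong[OF c(3), of "pairing u"] by (simp add: pairing_sum_right pairing_scale_right)
    finally have "0 < pairing u s" using a by (simp add: zero_less_mult_iff)
    with u show ?thesis by (auto simp: s_def)
  next
    case False
    have "\<exists>u. \<forall>i\<in>I. 0 < pairing u (project_along s (t i))"
    proof (rule insert.IH)
      fix c assume c: "\<forall>i\<in>I. 0 \<le> c i" "(\<Sum>i\<in>I. c i *s project_along s (t i)) = 0"
      from c(2) obtain a where "(\<Sum>i\<in>I. c i *s t i) = a *s s" by (rule sum_project_along_eq_0)
      then show "\<forall>i\<in>I. c i = 0" using False c(1) by blast
    qed
    then obtain u where u: "\<forall>i\<in>I. 0 < pairing u (project_along s (t i))" by blast
    define u' where "u' = project_along s u"
    have u's: "pairing u' s = 0"
      using \<open>s \<noteq> 0\<close> by (simp add: u'_def pairing_project_along_self)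
    have u't: "pairing u' (t i) = pairing u (project_along s (t i))" for i
      by (simp add: u'_def pairing_project_along)
    obtain k where k: "0 < k" "\<forall>i\<in>I. 0 < k * pairing u' (t i) + pairing s (t i)"
      using finite_mult_dominates[of I "\<lambda>i. pairing u' (t i)" "\<lambda>i. pairing s (t i)"] u u't insert.hyps
      by auto
    have "\<forall>i\<in>insert j I. 0 < pairing (k *s u' + s) (t i)"
      using k(2) u's ss by (auto simp: pairing_linear s_def)
    then show ?thesis by blast
  qed
qed

section \<open>Extremal rays of a pointed polyhedral cone\<close>

lemma cone_generatedI:
  assumes "\<And>s. s \<in> S \<Longrightarrow> 0 \<le> c s"
  shows "(\<Sum>s\<in>S. c s *s s) \<in> cone_generated S"
  using assms by (auto simp: cone_generated_def)

lemma cone_generated_zero: "0 \<in> cone_generated S"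
  using cone_generatedI[of S "\<lambda>_. 0"] by simp

lemma cone_generated_add:
  assumes "x \<in> cone_generated S" and "y \<in> cone_generated S"
  shows "x + y \<in> cone_generated S"
proof -
  obtain c d where "x = (\<Sum>s\<in>S. c s *s s)" "\<forall>s\<in>S. 0 \<le> c s"
    "y = (\<Sum>s\<in>S. d s *s s)" "\<forall>s\<in>S. 0 \<le> d s"
    using assms by (auto simp: cone_generated_def)
  then show ?thesis
    using cone_generatedI[of S "\<lambda>s. c s + d s"]
    by (simp add: vec.scale_left_distrib sum.distrib)
qed

lemma cone_generated_scale:
  assumes "x \<in> cone_generated S" and "0 \<le> a"
  shows "a *s x \<in> cone_generated S"
proof -
  obtain c where "x = (\<Sum>s\<in>S. c s *s s)" "\<forall>s\<in>S. 0 \<le> c s"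
    using assms by (auto simp: cone_generated_def)
  then show ?thesis
    using cone_generatedI[of S "\<lambda>s. a * c s"] assms by (simp add: vec.scale_sum_right)
qed

lemma cone_generated_sum:
  assumes "\<And>i. i \<in> I \<Longrightarrow> 0 \<le> c i" and "\<And>i. i \<in> I \<Longrightarrow> t i \<in> cone_generated S"
  shows "(\<Sum>i\<in>I. c i *s t i) \<in> cone_generated S"
  using assms
proof (induction I rule: infinite_finite_induct)
  case (insert i I)
  then show ?case by (simp add: cone_generated_add cone_generated_scale)
qed (simp_all add: cone_generated_zero)

lemma cone_generated_superset: "s \<in> cone_generated S" if "finite S" "s \<in> S"
proof -
  have "(\<Sum>t\<in>S. (if t = s then 1 else 0) *s t) = (\<Sum>t\<in>S. if t = s then s else 0)"
    by (intro sum.cong) auto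
  also have "\<dots> = s" using that by simp
  finally show ?thesis using cone_generatedI[of S "\<lambda>t. if t = s then 1 else 0"] by simp
qed

lemma cone_generated_subset:
  assumes "T \<subseteq> cone_generated S"
  shows "cone_generated T \<subseteq> cone_generated S"
proof
  fix x assume "x \<in> cone_generated T"
  then obtain c where "x = (\<Sum>t\<in>T. c t *s t)" "\<forall>t\<in>T. 0 \<le> c t"
    by (auto simp: cone_generated_def)
  then show "x \<in> cone_generated S" using cone_generated_sum[of T c "\<lambda>t. t" S] assms by auto
qed

text \<open>
  Modulo the line of \<open>s\<close> the other generators admit no nontrivial nonnegative relation: a relation
  \<open>\<Sum> c t = a s\<close> with \<open>a > 0\<close> would make \<open>s\<close> redundant, and one with \<open>a \<le> 0\<close> would contradict
  pointedness. Gordan's alternative for the projections along \<open>s\<close> then yields the form.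
\<close>
lemma exists_supporting_at_generator:
  assumes fin: "finite S" and pt: "pointed_cone (cone_generated S)"
    and s: "s \<in> S" and irr: "s \<notin> cone_generated (S - {s})" and zero: "0 \<notin> S"
  shows "\<exists>u. pairing u s = 0 \<and> (\<forall>t\<in>S - {s}. 0 < pairing u t)"
proof -
  have "\<exists>u. \<forall>t\<in>S - {s}. 0 < pairing u (project_along s t)"
  proof (rule gordan_alternative)
    show "finite (S - {s})" using fin by simp
    fix c assume c: "\<forall>t\<in>S - {s}. 0 \<le> c t" "(\<Sum>t\<in>S - {s}. c t *s project_along s t) = 0"
    from c(2) obtain a where a: "(\<Sum>t\<in>S - {s}. c t *s t) = a *s s"
      by (rule sum_project_along_eq_0)
    have a_le: "a \<le> 0"
    proof (rule ccontr)
      assume "\<not> a \<le> 0"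
      then have "s = inverse a *s (\<Sum>t\<in>S - {s}. c t *s t)" and "0 \<le> inverse a"
        by (simp_all add: a)
      then show False
        using irr cone_generated_scale[OF cone_generatedI[of "S - {s}" c], of "inverse a"] c(1)
        by auto
    qed
    show "\<forall>t\<in>S - {s}. c t = 0"
    proof (rule ccontr)
      assume "\<not> (\<forall>t\<in>S - {s}. c t = 0)"
      then obtain t where t: "t \<in> S - {s}" "c t \<noteq> 0" by blast
      \<comment> \<open>The relation exhibits \<open>- c t\<close> as an element of the cone.\<close>
      let ?y = "(\<Sum>r\<in>S - {s} - {t}. c r *s r) + (- a) *s s"
      have "c t *s t + (\<Sum>r\<in>S - {s} - {t}. c r *s r) = a *s s"
        using a sum.remove[of "S - {s}" t "\<lambda>t. c t *s t"] fin t by simp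
      then have "(\<Sum>r\<in>S - {s} - {t}. c r *s r) = a *s s - c t *s t"
        by (simp add: eq_diff_eq add.commute)
      then have "?y = - (c t *s t)" by simp
      moreover have "?y \<in> cone_generated S"
      proof (rule cone_generated_add)
        show "(\<Sum>r\<in>S - {s} - {t}. c r *s r) \<in> cone_generated S"
          using c(1) fin by (intro cone_generated_sum) (simp_all add: cone_generated_superset)
        show "(- a) *s s \<in> cone_generated S"
          using a_le by (intro cone_generated_scale cone_generated_superset[OF fin s]) simp
      qed
      moreover have "c t *s t \<in> cone_generated S"
        using c(1) t fin by (simp add: cone_generated_scale cone_generated_superset)
      ultimately have "c t *s t = 0" using pt by (auto simp: pointed_cone_def)
      then show False using t zero by auto
    qed
  qed
  then obtain u where u: "\<forall>t\<in>S - {s}. 0 < pairing u (project_along s t)" by blast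
  have "s \<noteq> 0" using s zero by blast
  with u show ?thesis
    by (intro exI[of _ "project_along s u"])
      (simp add: pairing_project_along project_along_self)
qed

text \<open>
  A generating set of least cardinality is irredundant.
\<close>
lemma irredundant_generators:
  assumes "polyhedral_cone \<sigma>"
  obtains S where "finite S" and "\<sigma> = cone_generated S"
    and "\<And>s. s \<in> S \<Longrightarrow> s \<notin> cone_generated (S - {s})" and "0 \<notin> S"
proof -
  let ?P = "\<lambda>S. finite S \<and> \<sigma> = cone_generated S"
  have "\<exists>S. ?P S" using assms by (simp add: polyhedral_cone_def)
  then obtain S where S: "?P S" and least: "\<And>T. ?P T \<Longrightarrow> card S \<le> card T"
    using ex_has_least_nat[of ?P _ card] by blast
  have irr: "s \<notin> cone_generated (S - {s})" if s: "s \<in> S" for s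
  proof
    assume "s \<in> cone_generated (S - {s})"
    then have "cone_generated S \<subseteq> cone_generated (S - {s})"
      using S by (intro cone_generated_subset) (auto intro: cone_generated_superset)
    moreover have "cone_generated (S - {s}) \<subseteq> cone_generated S"
      using S by (intro cone_generated_subset) (auto intro: cone_generated_superset)
    ultimately have "card S \<le> card (S - {s})" using S by (intro least) auto
    then show False using s S by (meson card_Diff1_less not_le)
  qed
  then have "0 \<notin> S" using cone_generated_zero by blast
  with S irr show ?thesis using that by blast
qed

text \<open>
  A description by integral forms of two rays spanning a common two-dimensional face.
\<close>
definition exposed_pair :: "(int ^ 'n) set \<Rightarrow> int ^ 'n \<Rightarrow> int ^ 'n \<Rightarrow> bool" where
  "exposed_pair R v r \<longleftrightarrow>
     (\<exists>u. pairing u v = 0 \<and> pairing u r = 0 \<and> (\<forall>s\<in>R - {v, r}. 0 < pairing u s))"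

definition ray_vectors :: "(rat ^ 'n) set \<Rightarrow> (int ^ 'n) set" where
  "ray_vectors \<sigma> = ray_vector ` extremal_rays \<sigma>"

context
  fixes \<sigma> :: "(rat ^ 'n) set"
  assumes poly: "polyhedral_cone \<sigma>" and pt: "pointed_cone \<sigma>"
begin

lemma scale_mem_cone: "c *s x \<in> \<sigma>" if "x \<in> \<sigma>" "0 \<le> c"
  using poly that cone_generated_scale by (auto simp: polyhedral_cone_def)

lemma ray_vector_props:
  assumes "\<rho> \<in> extremal_rays \<sigma>"
  shows "primitive_vector (ray_vector \<rho>)" and "rat_vec (ray_vector \<rho>) \<in> \<rho>"
  using theI'[OF ex1_ray_vector[OF poly pt assms]] by (simp_all add: ray_vector_def)

lemma extremal_ray_subset: "\<rho> \<subseteq> \<sigma>" if "\<rho> \<in> extremal_rays \<sigma>"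
  using that by (auto simp: extremal_rays_def cone_face_def)

text \<open>
  Dimension one puts the face on the line of \<open>y\<close>, and pointedness excludes the negative half.
\<close>
lemma extremal_ray_eq_multiples:
  assumes ray: "\<rho> \<in> extremal_rays \<sigma>" and y: "y \<in> \<rho>" "y \<noteq> 0"
  shows "\<rho> = {c *s y | c. 0 \<le> c}"
proof -
  obtain u where \<rho>: "\<rho> = {x\<in>\<sigma>. pairing u x = 0}" and dim: "vec.dim \<rho> = 1"
    using ray by (auto simp: extremal_rays_def cone_face_def)
  have "vec.independent {y}" using y by (simp add: vec.independent_insert)
  then have "\<rho> \<subseteq> vec.span {y}"
    using vec.card_ge_dim_independent[of "{y}" \<rho>] y dim by simp
  have "\<exists>c\<ge>0. x = c *s y" if x: "x \<in> \<rho>" for x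
  proof -
    obtain c where c: "x = c *s y"
      using x \<open>\<rho> \<subseteq> vec.span {y}\<close> by (auto simp: vec.span_singleton)
    have "0 \<le> c"
    proof (rule ccontr)
      assume "\<not> 0 \<le> c"
      then have "(- inverse c) *s x = - y" and "0 \<le> - inverse c"
        by (simp_all add: c)
      then have "- y \<in> \<sigma>" using scale_mem_cone[of x "- inverse c"] x \<rho> by simp
      then show False using y pt \<rho> by (auto simp: pointed_cone_def)
    qed
    with c show ?thesis by blast
  qed
  moreover have "c *s y \<in> \<rho>" if "0 \<le> c" for c
    using that y scale_mem_cone by (simp add: \<rho> pairing_scale_right)
  ultimately show ?thesis by blast
qed

lemma ray_vector_neq_0: "ray_vector \<rho> \<noteq> 0" if "\<rho> \<in> extremal_rays \<sigma>"
  using ray_vector_props[OF that] by (simp add: primitive_vector_def)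

lemma extremal_ray_eq:
  assumes "\<rho> \<in> extremal_rays \<sigma>"
  shows "\<rho> = {c *s rat_vec (ray_vector \<rho>) | c. 0 \<le> c}"
  using assms by (intro extremal_ray_eq_multiples) (simp_all add: ray_vector_props ray_vector_neq_0)

lemma extremal_rays_eqI:
  assumes rays: "\<rho> \<in> extremal_rays \<sigma>" "\<rho>' \<in> extremal_rays \<sigma>" and y: "y \<in> \<rho>" "y \<in> \<rho>'" "y \<noteq> 0"
  shows "\<rho> = \<rho>'"
  using extremal_ray_eq_multiples[OF rays(1) y(1,3)] extremal_ray_eq_multiples[OF rays(2) y(2,3)]
  by simp

lemma inj_on_ray_vector: "inj_on ray_vector (extremal_rays \<sigma>)"
proof (rule inj_onI)
  fix \<rho> \<rho>' assume *: "\<rho> \<in> extremal_rays \<sigma>" "\<rho>' \<in> extremal_rays \<sigma>" "ray_vector \<rho> = ray_vector \<rho>'"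
  show "\<rho> = \<rho>'"
    by (rule trans[OF extremal_ray_eq[OF *(1), unfolded *(3)] extremal_ray_eq[OF *(2), symmetric]])
qed

text \<open>
  The extremal rays are exactly the half-lines of an irredundant set of generators: each generator
  spans an exposed ray by its supporting form, and a nonzero vector of an extremal ray is a nonnegative
  combination of generators, of which those that occur lie in the ray.
\<close>
lemma finite_ray_vectors: "finite (ray_vectors \<sigma>)"
  and cone_generated_ray_vectors: "\<sigma> = cone_generated (rat_vec ` ray_vectors \<sigma>)"
proof -
  obtain S where S: "finite S" "\<sigma> = cone_generated S"
    and irr: "\<And>s. s \<in> S \<Longrightarrow> s \<notin> cone_generated (S - {s})" and zero: "0 \<notin> S"
    using irredundant_generators[OF poly] by blast
  have gen_ray: "{c *s s | c. 0 \<le> c} \<in> extremal_rays \<sigma>" if s: "s \<in> S" for s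
  proof -
    obtain u where u: "pairing u s = 0" "\<forall>t\<in>S - {s}. 0 < pairing u t"
      using exists_supporting_at_generator[OF S(1) _ s irr[OF s] zero] pt S(2) by blast
    have u_nonneg: "0 \<le> pairing u t" if "t \<in> S" for t
      using u that by (cases "t = s") (auto intro: less_imp_le)
    have u_zero: "0 \<le> pairing u x \<and> (pairing u x = 0 \<longrightarrow> (\<exists>c\<ge>0. x = c *s s))" if x: "x \<in> \<sigma>" for x
    proof -
      obtain d where d: "x = (\<Sum>t\<in>S. d t *s t)" "\<forall>t\<in>S. 0 \<le> d t"
        using x unfolding S(2) by (auto simp: cone_generated_def)
      have px: "pairing u x = (\<Sum>t\<in>S. d t * pairing u t)"
        by (simp add: d(1) pairing_sum_right pairing_scale_right)
      have "0 \<le> pairing u x" using d(2) u_nonneg by (auto simp: px intro!: sum_nonneg)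
      moreover have "\<exists>c\<ge>0. x = c *s s" if "pairing u x = 0"
      proof -
        have "\<forall>t\<in>S. d t * pairing u t = 0"
          using that sum_nonneg_eq_0_iff[OF S(1), of "\<lambda>t. d t * pairing u t"] d(2) u_nonneg
          by (simp add: px)
        then have "\<forall>t\<in>S - {s}. d t = 0" using u(2) by (metis DiffD1 less_irrefl mult_eq_0_iff)
        then have "(\<Sum>t\<in>S - {s}. d t *s t) = 0" by (intro sum.neutral) simp
        then have "x = d s *s s"
          unfolding d(1) sum.remove[OF S(1) s, of "\<lambda>t. d t *s t"] by simp
        then show ?thesis using d(2) s by blast
      qed
      ultimately show ?thesis by blast
    qed
    have mem: "c *s s \<in> \<sigma>" if "0 \<le> c" for c
      using that s S(1) unfolding S(2) by (simp add: cone_generated_scale cone_generated_superset)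
    have "{c *s s | c. 0 \<le> c} = {x \<in> \<sigma>. pairing u x = 0}"
      using u(1) u_zero mem by (fastforce simp: pairing_scale_right)
    moreover have "u \<in> dual_cone \<sigma>" using u_zero by (simp add: dual_cone_def)
    ultimately have "cone_face {c *s s | c. 0 \<le> c} \<sigma>" unfolding cone_face_def by blast
    moreover have "vec.dim {c *s s | c. 0 \<le> c} = 1"
    proof (rule vec.dim_unique[of "{s}"])
      show "{s} \<subseteq> {c *s s | c. 0 \<le> c}" by (auto intro: exI[of _ 1])
      show "{c *s s | c. 0 \<le> c} \<subseteq> vec.span {s}" by (auto simp: vec.span_singleton)
      show "vec.independent {s}" using s zero by (auto simp: vec.independent_insert)
    qed simp
    ultimately show ?thesis by (simp add: extremal_rays_def)
  qed
  have "extremal_rays \<sigma> \<subseteq> (\<lambda>s. {c *s s | c. 0 \<le> c}) ` S"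
  proof
    fix \<rho> assume \<rho>: "\<rho> \<in> extremal_rays \<sigma>"
    then obtain u where u: "u \<in> dual_cone \<sigma>" "\<rho> = {x\<in>\<sigma>. pairing u x = 0}"
      by (auto simp: extremal_rays_def cone_face_def)
    let ?v = "rat_vec (ray_vector \<rho>)"
    have v: "?v \<in> \<sigma>" "pairing u ?v = 0" using ray_vector_props(2)[OF \<rho>] u(2) by auto
    then obtain d where d: "?v = (\<Sum>t\<in>S. d t *s t)" "\<forall>t\<in>S. 0 \<le> d t"
      unfolding S(2) by (auto simp: cone_generated_def)
    obtain t where t: "t \<in> S" "d t \<noteq> 0"
      using ray_vector_neq_0[OF \<rho>] d(1)
      by (metis (no_types, lifting) rat_vec_eq_0_iff sum.neutral vec.scale_eq_0_iff)
    have S_nonneg: "0 \<le> pairing u t" if "t \<in> S" for t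
      using u(1) that S(1) unfolding S(2) by (simp add: dual_cone_def cone_generated_superset)
    have "(\<Sum>t\<in>S. d t * pairing u t) = 0"
      using v(2) by (simp add: d(1) pairing_sum_right pairing_scale_right)
    then have "d t * pairing u t = 0"
      using sum_nonneg_eq_0_iff[OF S(1), of "\<lambda>t. d t * pairing u t"] d(2) S_nonneg t(1)
      by (meson mult_nonneg_nonneg)
    then have "pairing u t = 0" using t(2) by simp
    moreover have "t \<in> \<sigma>" unfolding S(2) using S(1) t(1) by (rule cone_generated_superset)
    ultimately have "t \<in> \<rho>" unfolding u(2) by blast
    moreover have "t \<noteq> 0" using t zero by blast
    ultimately show "\<rho> \<in> (\<lambda>s. {c *s s | c. 0 \<le> c}) ` S"
      using extremal_ray_eq_multiples[OF \<rho>] t(1) by blast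
  qed
  then have "finite (extremal_rays \<sigma>)" using S(1) finite_surj by blast
  then show fin: "finite (ray_vectors \<sigma>)" by (simp add: ray_vectors_def)
  have "S \<subseteq> cone_generated (rat_vec ` ray_vectors \<sigma>)"
  proof
    fix s assume s: "s \<in> S"
    have "s \<in> {c *s s | c. 0 \<le> c}" by (auto intro: exI[of _ 1])
    then obtain \<rho> where \<rho>: "\<rho> \<in> extremal_rays \<sigma>" "s \<in> \<rho>" using gen_ray[OF s] by blast
    then obtain c where "s = c *s rat_vec (ray_vector \<rho>)" "0 \<le> c"
      using extremal_ray_eq[OF \<rho>(1)] by blast
    then show "s \<in> cone_generated (rat_vec ` ray_vectors \<sigma>)"
      using \<rho>(1) fin by (simp add: ray_vectors_def cone_generated_scale cone_generated_superset)
  qed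
  then have "\<sigma> \<subseteq> cone_generated (rat_vec ` ray_vectors \<sigma>)"
    unfolding S(2) by (rule cone_generated_subset)
  moreover have "rat_vec ` ray_vectors \<sigma> \<subseteq> cone_generated S"
    unfolding S(2)[symmetric] ray_vectors_def using ray_vector_props(2) extremal_ray_subset by blast
  then have "cone_generated (rat_vec ` ray_vectors \<sigma>) \<subseteq> \<sigma>"
    unfolding S(2) by (rule cone_generated_subset)
  ultimately show "\<sigma> = cone_generated (rat_vec ` ray_vectors \<sigma>)" by (rule subset_antisym)
qed

lemma rat_vec_mem_cone: "rat_vec r \<in> \<sigma>" if "r \<in> ray_vectors \<sigma>"
  using that ray_vector_props(2) extremal_ray_subset by (auto simp: ray_vectors_def)

lemma cone_mem_sum:
  assumes "x \<in> \<sigma>"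
  obtains c where "\<And>r. r \<in> ray_vectors \<sigma> \<Longrightarrow> 0 \<le> c r"
    and "x = (\<Sum>r\<in>ray_vectors \<sigma>. c r *s rat_vec r)"
proof -
  have inj: "inj_on rat_vec (ray_vectors \<sigma>)"
    by (auto simp: inj_on_def rat_vec_def vec_eq_iff)
  obtain c where "x = (\<Sum>s\<in>rat_vec ` ray_vectors \<sigma>. c s *s s)" "\<forall>s\<in>rat_vec ` ray_vectors \<sigma>. 0 \<le> c s"
    using subsetD[OF equalityD1[OF cone_generated_ray_vectors] assms]
    by (auto simp: cone_generated_def)
  then show ?thesis using that[of "\<lambda>r. c (rat_vec r)"] by (simp add: sum.reindex[OF inj])
qed

lemma rat_vec_mem_dual_cone_iff:
  "rat_vec m \<in> dual_cone \<sigma> \<longleftrightarrow> (\<forall>r\<in>ray_vectors \<sigma>. 0 \<le> pairing m r)"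
proof
  assume "rat_vec m \<in> dual_cone \<sigma>"
  then have "0 \<le> pairing (rat_vec m) (rat_vec r)" if "r \<in> ray_vectors \<sigma>" for r
    using that rat_vec_mem_cone unfolding dual_cone_def by blast
  then show "\<forall>r\<in>ray_vectors \<sigma>. 0 \<le> pairing m r" by (simp add: pairing_rat_vec)
next
  assume m: "\<forall>r\<in>ray_vectors \<sigma>. 0 \<le> pairing m r"
  have "0 \<le> pairing (rat_vec m) x" if x: "x \<in> \<sigma>" for x
  proof -
    obtain c where "\<And>r. r \<in> ray_vectors \<sigma> \<Longrightarrow> 0 \<le> c r"
      and "x = (\<Sum>r\<in>ray_vectors \<sigma>. c r *s rat_vec r)"
      using cone_mem_sum[OF x] by blast
    then show ?thesis
      using m by (auto simp: pairing_sum_right pairing_scale_right pairing_rat_vec intro!: sum_nonneg)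
  qed
  then show "rat_vec m \<in> dual_cone \<sigma>" by (simp add: dual_cone_def)
qed

lemma integral_supporting_form:
  assumes "cone_face \<tau> \<sigma>"
  obtains u where "\<And>r. r \<in> ray_vectors \<sigma> \<Longrightarrow> 0 \<le> pairing u r"
    and "\<tau> = {x\<in>\<sigma>. pairing (rat_vec u) x = 0}"
proof -
  obtain w where w: "w \<in> dual_cone \<sigma>" "\<tau> = {x\<in>\<sigma>. pairing w x = 0}"
    using assms by (auto simp: cone_face_def)
  obtain d u where u: "0 < d" "rat_vec u = of_int d *s w" using clear_denominators by blast
  have "rat_vec u \<in> dual_cone \<sigma>"
    using u w(1) by (simp add: dual_cone_def pairing_scale_left)
  moreover have "\<tau> = {x\<in>\<sigma>. pairing (rat_vec u) x = 0}"
    using u w(2) by (simp add: pairing_scale_left)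
  ultimately show ?thesis using that[of u] by (simp add: rat_vec_mem_dual_cone_iff)
qed

text \<open>
  The form exposing the ray itself, cleared of denominators.
\<close>
lemma ray_facet:
  assumes "r \<in> ray_vectors \<sigma>"
  shows "\<exists>u. pairing u r = 0 \<and> (\<forall>s\<in>ray_vectors \<sigma> - {r}. 0 < pairing u s)"
proof -
  obtain \<rho> where \<rho>: "\<rho> \<in> extremal_rays \<sigma>" "r = ray_vector \<rho>"
    using assms by (auto simp: ray_vectors_def)
  then have "cone_face \<rho> \<sigma>" by (simp add: extremal_rays_def)
  then obtain u where u: "\<And>r. r \<in> ray_vectors \<sigma> \<Longrightarrow> 0 \<le> pairing u r"
    and \<rho>_eq: "\<rho> = {x\<in>\<sigma>. pairing (rat_vec u) x = 0}"
    using integral_supporting_form by blast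
  have "rat_vec r \<in> \<rho>" using ray_vector_props(2)[OF \<rho>(1)] \<rho>(2) by simp
  then have "pairing (rat_vec u) (rat_vec r) = 0" using \<rho>_eq by blast
  then have "pairing u r = 0" by (simp add: pairing_rat_vec)
  moreover have "0 < pairing u s" if s: "s \<in> ray_vectors \<sigma> - {r}" for s
  proof (rule ccontr)
    assume "\<not> 0 < pairing u s"
    then have "pairing u s = 0" using u[of s] s by auto
    then have "pairing (rat_vec u) (rat_vec s) = 0" by (simp add: pairing_rat_vec)
    then have s\<rho>: "rat_vec s \<in> \<rho>"
      using rat_vec_mem_cone[of s] s \<rho>_eq by blast
    obtain \<rho>' where \<rho>': "\<rho>' \<in> extremal_rays \<sigma>" "s = ray_vector \<rho>'"
      using s by (auto simp: ray_vectors_def)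
    then have "\<rho> = \<rho>'"
      using extremal_rays_eqI[OF \<rho>(1) \<rho>'(1) s\<rho>] ray_vector_props(2)[OF \<rho>'(1)] ray_vector_neq_0[OF \<rho>'(1)]
      by simp
    then show False using s \<rho>(2) \<rho>'(2) by simp
  qed
  ultimately show ?thesis by blast
qed

lemma ray_vectors_nonzero: "0 \<notin> ray_vectors \<sigma>"
  using ray_vector_neq_0 by (auto simp: ray_vectors_def)

lemma independent_ray_vectors:
  assumes "v \<in> ray_vectors \<sigma>" "r \<in> ray_vectors \<sigma>" "v \<noteq> r"
  shows "vec.independent {rat_vec v, rat_vec r}" and "card {rat_vec v, rat_vec r} = 2"
proof -
  have "r \<noteq> 0" using assms ray_vectors_nonzero by blast
  have "rat_vec v \<notin> vec.span {rat_vec r}"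
  proof
    assume "rat_vec v \<in> vec.span {rat_vec r}"
    then obtain c where c: "rat_vec v = c *s rat_vec r" by (auto simp: vec.span_singleton)
    obtain u where u: "pairing u r = 0" "0 < pairing u v" using ray_facet[OF assms(2)] assms by blast
    have "pairing (rat_vec u) (rat_vec v) = c * pairing (rat_vec u) (rat_vec r)"
      by (simp add: c pairing_scale_right)
    then show False using u by (simp add: pairing_rat_vec)
  qed
  then show "vec.independent {rat_vec v, rat_vec r}"
    using \<open>r \<noteq> 0\<close> by (simp add: vec.independent_insert vec.span_base)
  show "card {rat_vec v, rat_vec r} = 2"
    using assms(3) by (auto simp: rat_vec_def vec_eq_iff card_2_iff)
qed

text \<open>
  Besides \<open>\<rho>\<close> and \<open>\<rho>'\<close> no ray \<open>s\<close> can lie in the two-dimensional face. Otherwise \<open>s = a v + b r\<close>,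
  where the facet forms of \<open>v\<close> and \<open>r\<close> force \<open>a, b > 0\<close>, and then the facet form of \<open>s\<close> would be
  positive on \<open>s\<close>.
\<close>
lemma exposed_pair_of_adjacent:
  assumes \<rho>: "\<rho> \<in> extremal_rays \<sigma>" and adj: "\<rho>' \<in> adjacent_rays \<sigma> \<rho>"
  shows "exposed_pair (ray_vectors \<sigma>) (ray_vector \<rho>) (ray_vector \<rho>')"
proof -
  let ?v = "ray_vector \<rho>" and ?r = "ray_vector \<rho>'"
  obtain \<tau> where \<rho>': "\<rho>' \<in> extremal_rays \<sigma>" "\<rho>' \<noteq> \<rho>"
    and \<tau>: "cone_face \<tau> \<sigma>" "vec.dim \<tau> = 2" "\<rho> \<subseteq> \<tau>" "\<rho>' \<subseteq> \<tau>"
    using adj by (auto simp: adjacent_rays_def)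
  obtain u where u: "\<And>s. s \<in> ray_vectors \<sigma> \<Longrightarrow> 0 \<le> pairing u s"
    and \<tau>_eq: "\<tau> = {x\<in>\<sigma>. pairing (rat_vec u) x = 0}"
    using integral_supporting_form[OF \<tau>(1)] by blast
  have R: "?v \<in> ray_vectors \<sigma>" "?r \<in> ray_vectors \<sigma>" using \<rho> \<rho>' by (auto simp: ray_vectors_def)
  have "?v \<noteq> ?r" using inj_on_ray_vector \<rho> \<rho>' by (auto dest: inj_onD)
  note ind = independent_ray_vectors[OF R \<open>?v \<noteq> ?r\<close>]
  have mem: "rat_vec ?v \<in> \<tau>" "rat_vec ?r \<in> \<tau>"
    using ray_vector_props(2)[OF \<rho>] ray_vector_props(2)[OF \<rho>'(1)] \<tau>(3,4) by blast+
  have span: "\<tau> \<subseteq> vec.span {rat_vec ?v, rat_vec ?r}"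
    using vec.card_ge_dim_independent[of "{rat_vec ?v, rat_vec ?r}" \<tau>] mem ind \<tau>(2) by simp
  have "pairing (rat_vec u) (rat_vec ?v) = 0" "pairing (rat_vec u) (rat_vec ?r) = 0"
    using mem \<tau>_eq by blast+
  then have u0: "pairing u ?v = 0" "pairing u ?r = 0" by (simp_all add: pairing_rat_vec)
  moreover have "0 < pairing u s" if s: "s \<in> ray_vectors \<sigma> - {?v, ?r}" for s
  proof (rule ccontr)
    assume "\<not> 0 < pairing u s"
    then have "pairing u s = 0" using u[of s] s by auto
    then have "pairing (rat_vec u) (rat_vec s) = 0" by (simp add: pairing_rat_vec)
    then have "rat_vec s \<in> \<tau>" using rat_vec_mem_cone[of s] s \<tau>_eq by blast
    then have "rat_vec s \<in> vec.span {rat_vec ?v, rat_vec ?r}" using span by blast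
    then obtain a b where ab: "rat_vec s = a *s rat_vec ?v + b *s rat_vec ?r"
      by (auto simp: vec.span_insert vec.span_singleton algebra_simps)
    have eval: "of_int (pairing w s) = a * of_int (pairing w ?v) + b * of_int (pairing w ?r)" for w
      using arg_cong[OF ab, of "pairing (rat_vec w)"]
      by (simp add: pairing_add_right pairing_scale_right pairing_rat_vec)
    have diff: "?r \<in> ray_vectors \<sigma> - {?v}" "s \<in> ray_vectors \<sigma> - {?v}"
      "?v \<in> ray_vectors \<sigma> - {?r}" "s \<in> ray_vectors \<sigma> - {?r}"
      "?v \<in> ray_vectors \<sigma> - {s}" "?r \<in> ray_vectors \<sigma> - {s}" "s \<in> ray_vectors \<sigma>"
      using R s \<open>?v \<noteq> ?r\<close> by auto
    obtain f where f: "pairing f ?v = 0" "0 < pairing f ?r" "0 < pairing f s"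
      using ray_facet[OF R(1)] diff(1,2) by blast
    obtain g where g: "pairing g ?r = 0" "0 < pairing g ?v" "0 < pairing g s"
      using ray_facet[OF R(2)] diff(3,4) by blast
    obtain h where h: "pairing h s = 0" "0 < pairing h ?v" "0 < pairing h ?r"
      using ray_facet[OF diff(7)] diff(5,6) by blast
    have "0 < b * of_int (pairing f ?r)" using eval[of f] f by simp
    then have b: "0 < b" using f(2) by (simp add: zero_less_mult_iff)
    have "0 < a * of_int (pairing g ?v)" using eval[of g] g by simp
    then have a: "0 < a" using g(2) by (simp add: zero_less_mult_iff)
    have "0 < a * of_int (pairing h ?v)" "0 < b * of_int (pairing h ?r)" using a b h by simp_all
    then show False using eval[of h] h(1) by simp
  qed
  ultimately show ?thesis by (auto simp: exposed_pair_def)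
qed

text \<open>
  The face cut out by the form contains only combinations of the two ray vectors, because a
  nonnegative combination of all rays on which the form vanishes has no contribution from the rays
  where it is positive.
\<close>
lemma adjacent_of_exposed_pair:
  assumes \<rho>: "\<rho> \<in> extremal_rays \<sigma>" and \<rho>': "\<rho>' \<in> extremal_rays \<sigma>" "\<rho>' \<noteq> \<rho>"
    and exposed: "exposed_pair (ray_vectors \<sigma>) (ray_vector \<rho>) (ray_vector \<rho>')"
  shows "\<rho>' \<in> adjacent_rays \<sigma> \<rho>"
proof -
  let ?v = "ray_vector \<rho>" and ?r = "ray_vector \<rho>'" and ?R = "ray_vectors \<sigma>"
  obtain u where u: "pairing u ?v = 0" "pairing u ?r = 0"
    and u_pos: "\<And>s. s \<in> ?R - {?v, ?r} \<Longrightarrow> 0 < pairing u s"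
    using exposed by (auto simp: exposed_pair_def)
  have u_nonneg: "0 \<le> pairing u s" if "s \<in> ?R" for s
    using u u_pos[of s] that by (cases "s = ?v \<or> s = ?r") auto
  have R: "?v \<in> ?R" "?r \<in> ?R" using \<rho> \<rho>' by (auto simp: ray_vectors_def)
  have "?v \<noteq> ?r" using inj_on_ray_vector \<rho> \<rho>' by (auto dest: inj_onD)
  note ind = independent_ray_vectors[OF R \<open>?v \<noteq> ?r\<close>]
  define \<tau> where "\<tau> = {x\<in>\<sigma>. pairing (rat_vec u) x = 0}"
  have "rat_vec u \<in> dual_cone \<sigma>" using u_nonneg by (simp add: rat_vec_mem_dual_cone_iff)
  then have face: "cone_face \<tau> \<sigma>" by (auto simp: cone_face_def \<tau>_def)
  have "\<tau> \<subseteq> vec.span {rat_vec ?v, rat_vec ?r}"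
  proof
    fix x assume x: "x \<in> \<tau>"
    then have "x \<in> \<sigma>" by (simp add: \<tau>_def)
    then obtain c where c: "\<And>s. s \<in> ?R \<Longrightarrow> 0 \<le> c s" and x_eq: "x = (\<Sum>s\<in>?R. c s *s rat_vec s)"
      by (rule cone_mem_sum) blast
    have term_nonneg: "0 \<le> c s * of_int (pairing u s)" if "s \<in> ?R" for s
      using c u_nonneg that by simp
    have "(\<Sum>s\<in>?R. c s * of_int (pairing u s)) = 0"
      using x by (simp add: \<tau>_def x_eq pairing_sum_right pairing_scale_right pairing_rat_vec)
    then have "\<forall>s\<in>?R. c s * of_int (pairing u s) = 0"
      using sum_nonneg_eq_0_iff[OF finite_ray_vectors, of "\<lambda>s. c s * of_int (pairing u s)"] term_nonneg
      by blast
    then have zero: "c s = 0" if "s \<in> ?R" "s \<noteq> ?v" "s \<noteq> ?r" for s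
      using u_pos[of s] that by fastforce
    have "c s *s rat_vec s \<in> vec.span {rat_vec ?v, rat_vec ?r}" if "s \<in> ?R" for s
    proof (cases "s = ?v \<or> s = ?r")
      case True
      then show ?thesis by (auto intro: vec.span_scale vec.span_base)
    next
      case False
      then show ?thesis using zero that by (simp add: vec.span_zero)
    qed
    then show "x \<in> vec.span {rat_vec ?v, rat_vec ?r}" unfolding x_eq by (rule vec.span_sum)
  qed
  moreover have sub: "{rat_vec ?v, rat_vec ?r} \<subseteq> \<tau>"
    using rat_vec_mem_cone R u by (simp add: \<tau>_def pairing_rat_vec)
  ultimately have dim: "vec.dim \<tau> = 2" using vec.dim_unique[OF sub _ ind] by blast
  have "\<rho>0 \<subseteq> \<tau>" if \<rho>0: "\<rho>0 \<in> extremal_rays \<sigma>" and u0: "pairing u (ray_vector \<rho>0) = 0" for \<rho>0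
  proof
    fix x assume x: "x \<in> \<rho>0"
    then obtain c where "x = c *s rat_vec (ray_vector \<rho>0)" using extremal_ray_eq[OF \<rho>0] by blast
    then have "pairing (rat_vec u) x = 0" by (simp add: u0 pairing_scale_right pairing_rat_vec)
    then show "x \<in> \<tau>" using x extremal_ray_subset[OF \<rho>0] by (auto simp: \<tau>_def)
  qed
  then have "\<rho> \<subseteq> \<tau>" "\<rho>' \<subseteq> \<tau>" using \<rho> \<rho>'(1) u by blast+
  then show ?thesis using face dim \<rho>' by (auto simp: adjacent_rays_def)
qed

end

section \<open>Linear forms on the lattice\<close>

lemma additive_int_scale:
  fixes h :: "int ^ 'n \<Rightarrow> 'k::ring_1"
  assumes "Modules.additive h"
  shows "h (k *s m) = of_int k * h m"
proof -
  interpret Modules.additive h by (rule assms)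
  have nat: "h (int n *s m) = of_nat n * h m" for n
  proof (induction n)
    case (Suc n)
    have "int (Suc n) *s m = int n *s m + m" by (simp add: vec.scale_left_distrib)
    then show ?case using Suc by (simp add: add distrib_right)
  qed (simp add: zero)
  show ?thesis
  proof (cases "0 \<le> k")
    case True
    then show ?thesis using nat[of "nat k"] by simp
  next
    case False
    then have "k *s m = - (int (nat (- k)) *s m)" by (simp add: vec_eq_iff)
    then have "h (k *s m) = - (of_nat (nat (- k)) * h m)" using nat by (simp only: minus)
    also have "of_nat (nat (- k)) = (- of_int k :: 'k)" using False by simp
    finally show ?thesis by simp
  qed
qed

lemma additive_eq_0_on_axes:
  fixes h :: "int ^ 'n \<Rightarrow> 'k::ring_1"
  assumes "Modules.additive h" and "\<And>i. h (axis i 1) = 0"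
  shows "h m = 0"
proof -
  interpret Modules.additive h by (rule assms(1))
  have "h m = h (\<Sum>i\<in>UNIV. (m $ i) *s axis i 1)" by (simp add: basis_expansion)
  also have "\<dots> = 0" by (simp add: sum additive_int_scale[OF assms(1)] assms(2))
  finally show ?thesis .
qed

text \<open>
  One coordinate-free way to avoid finitely many hyperplanes: when the form found so far vanishes
  on the new vector \<open>d\<close>, replace it by a large multiple of itself plus \<open>d\<close>.
\<close>
lemma nonvanishing_form:
  fixes K :: "(int ^ 'n) set"
  assumes "finite K" and "0 \<notin> K"
  shows "\<exists>l. \<forall>d\<in>K. pairing d l \<noteq> 0"
  using assms
proof (induction K)
  case empty
  then show ?case by simp
next
  case (insert d K)
  then obtain l where l: "\<forall>x\<in>K. pairing x l \<noteq> 0" by auto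
  show ?case
  proof (cases "pairing d l = 0")
    case True
    have "\<And>x. x \<in> K \<Longrightarrow> 0 < \<bar>pairing x l\<bar>" using l by simp
    then obtain k where "\<forall>x\<in>K. 0 < k * \<bar>pairing x l\<bar> + - \<bar>pairing x d\<bar>"
      using finite_int_mult_dominates[OF insert.hyps(1), of "\<lambda>x. \<bar>pairing x l\<bar>" "\<lambda>x. - \<bar>pairing x d\<bar>"]
      by blast
    then have k: "\<bar>pairing x d\<bar> < k * \<bar>pairing x l\<bar>" if "x \<in> K" for x using that by force
    have "pairing x (k *s l + d) \<noteq> 0" if x: "x \<in> K" for x
    proof
      assume "pairing x (k *s l + d) = 0"
      then have "k * pairing x l = - pairing x d" by (simp add: pairing_linear)
      then have "\<bar>k\<bar> * \<bar>pairing x l\<bar> = \<bar>pairing x d\<bar>" by (metis abs_minus_cancel abs_mult)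
      moreover have "k * \<bar>pairing x l\<bar> \<le> \<bar>k\<bar> * \<bar>pairing x l\<bar>" by (simp add: mult_right_mono)
      ultimately show False using k[OF x] by linarith
    qed
    moreover have "pairing d (k *s l + d) \<noteq> 0"
      using True pairing_self_pos[of d] insert.prems by (simp add: pairing_linear)
    ultimately show ?thesis by blast
  next
    case False
    with l show ?thesis by blast
  qed
qed

text \<open>
  Such a form orders a finite set of weights without ties. It serves as a substitute for a monomial
  order when leading terms are compared.
\<close>
lemma injective_form:
  fixes K :: "(int ^ 'n) set"
  assumes "finite K"
  obtains l where "inj_on (\<lambda>m. pairing m l) K"
proof -
  let ?D = "(\<lambda>(m, m'). m - m') ` (K \<times> K) - {0}"
  obtain l where l: "\<forall>d\<in>?D. pairing d l \<noteq> 0"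
    using nonvanishing_form[of ?D] assms by auto
  have "inj_on (\<lambda>m. pairing m l) K"
  proof (rule inj_onI, rule ccontr)
    fix m m' assume m: "m \<in> K" "m' \<in> K" "pairing m l = pairing m' l" "m \<noteq> m'"
    then have "m - m' \<in> ?D" by force
    then have "pairing (m - m') l \<noteq> 0" using l by blast
    then show False using m(3) by (simp add: pairing_diff_left)
  qed
  then show ?thesis using that by blast
qed

section \<open>The homogeneous derivation of a root\<close>

lemma lookup_times_single:
  fixes f :: "int ^ 'n \<Rightarrow>\<^sub>0 'k::comm_ring_1"
  shows "Poly_Mapping.lookup (f * Poly_Mapping.single m c) \<mu> = Poly_Mapping.lookup f (\<mu> - m) * c"
proof -
  have "(\<Sum>q. Poly_Mapping.lookup (Poly_Mapping.single m c) q when \<mu> = l + q) = (c when l = \<mu> - m)" for l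
  proof -
    have "(\<lambda>q. Poly_Mapping.lookup (Poly_Mapping.single m c) q when \<mu> = l + q) = (\<lambda>q. (c when l = \<mu> - m) when q = m)"
      by (auto simp: lookup_single when_def fun_eq_iff)
    then show ?thesis by (simp only: Sum_any_when_equal)
  qed
  then have "Poly_Mapping.lookup (f * Poly_Mapping.single m c) \<mu> = (\<Sum>l. Poly_Mapping.lookup f l * c when l = \<mu> - m)"
    by (simp add: lookup_mult mult_when)
  then show ?thesis by simp
qed

lemma sum_single_keys:
  "f = (\<Sum>m\<in>Poly_Mapping.keys f. Poly_Mapping.single m (Poly_Mapping.lookup f m))"
proof (rule poly_mapping_eqI)
  fix \<mu>
  show "Poly_Mapping.lookup f \<mu> = Poly_Mapping.lookup (\<Sum>m\<in>Poly_Mapping.keys f. Poly_Mapping.single m (Poly_Mapping.lookup f m)) \<mu>"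
    by (auto simp: lookup_sum lookup_single when_def in_keys_iff)
qed

lemma poly_mapping_single_induct [case_names zero single add]:
  fixes f :: "'a \<Rightarrow>\<^sub>0 'b::comm_monoid_add"
  assumes "Q 0" and "\<And>m c. Q (Poly_Mapping.single m c)" and "\<And>f g. Q f \<Longrightarrow> Q g \<Longrightarrow> Q (f + g)"
  shows "Q f"
proof -
  have "Q (\<Sum>m\<in>K. Poly_Mapping.single m (Poly_Mapping.lookup f m))" if "finite K" for K
    using that by induction (simp_all add: assms)
  then show ?thesis by (subst sum_single_keys) simp
qed

text \<open>
  The derivation \<open>\<delta>\<^sub>e\<close> as a function of the vector \<open>v\<close> alone, so that it makes sense without a cone.
\<close>
definition root_derivation ::
  "int ^ 'n \<Rightarrow> int ^ 'n \<Rightarrow> (int ^ 'n \<Rightarrow>\<^sub>0 'k::comm_ring_1) \<Rightarrow> (int ^ 'n \<Rightarrow>\<^sub>0 'k)" where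
  "root_derivation v e f = (\<Sum>m\<in>Poly_Mapping.keys f.
     Poly_Mapping.single (m + e) (Poly_Mapping.lookup f m * of_int (pairing m v)))"

lemma demazure_lnd_eq: "demazure_lnd \<rho> e = root_derivation (ray_vector \<rho>) e"
  by (simp add: demazure_lnd_def root_derivation_def fun_eq_iff)

lemma lookup_root_derivation:
  "Poly_Mapping.lookup (root_derivation v e f) \<mu> = Poly_Mapping.lookup f (\<mu> - e) * of_int (pairing (\<mu> - e) v)"
proof -
  have "m + e = \<mu> \<longleftrightarrow> m = \<mu> - e" for m by (auto simp: algebra_simps)
  then show ?thesis
    by (simp add: root_derivation_def lookup_sum lookup_single when_def in_keys_iff)
qed

lemma root_derivation_zero [simp]: "root_derivation v e 0 = 0"
  by (simp add: root_derivation_def)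

lemma root_derivation_add: "root_derivation v e (f + g) = root_derivation v e f + root_derivation v e g"
  by (rule poly_mapping_eqI) (simp add: lookup_root_derivation lookup_add distrib_right)

lemma root_derivation_single:
  "root_derivation v e (Poly_Mapping.single m c) = Poly_Mapping.single (m + e) (c * of_int (pairing m v))"
  by (simp add: root_derivation_def)

text \<open>
  Both sides are biadditive, so it suffices to compare them on characters.
\<close>
lemma root_derivation_mult:
  "root_derivation v e (f * g) = root_derivation v e f * g + f * root_derivation v e g"
proof (induction f rule: poly_mapping_single_induct)
  case (single m c)
  show ?case
  proof (induction g rule: poly_mapping_single_induct)
    case (single m' c')
    have "c * c' * of_int (pairing (m + m') v)
        = c * of_int (pairing m v) * c' + c * (c' * of_int (pairing m' v))"
      by (simp add: pairing_add_left algebra_simps)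
    then show ?case
      by (simp add: root_derivation_single mult_single single_add[symmetric] add_ac)
  next
    case (add f g)
    then show ?case by (simp add: root_derivation_add distrib_left add_ac)
  qed simp
next
  case (add f g)
  then show ?case by (simp add: root_derivation_add distrib_right add_ac)
qed simp

lemma root_derivation_scale:
  "root_derivation v e (Poly_Mapping.single 0 c * f) = Poly_Mapping.single 0 c * root_derivation v e f"
  by (simp add: root_derivation_mult root_derivation_single)

lemma root_derivations_commute:
  fixes e e' v v' :: "int ^ 'n"
  assumes "pairing e v' = 0" and "pairing e' v = 0"
  shows "root_derivation v e (root_derivation v' e' f) = root_derivation v' e' (root_derivation v e f)"
proof (rule poly_mapping_eqI)
  fix \<mu> :: "int ^ 'n"
  have eq: "\<mu> - e' - e = \<mu> - e - e'" by (simp add: algebra_simps)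
  show "Poly_Mapping.lookup (root_derivation v e (root_derivation v' e' f)) \<mu>
      = Poly_Mapping.lookup (root_derivation v' e' (root_derivation v e f)) \<mu>"
    unfolding lookup_root_derivation eq using assms by (simp add: pairing_diff_left mult_ac)
qed

section \<open>Weights of a system of rays\<close>

text \<open>
  All that the algebra needs to know of the cone: its finitely many ray vectors are nonzero, and each
  of them spans a face of dimension one of the cone generated by all. Integral forms replace rational
  duality from here on.
\<close>
locale ray_system =
  fixes R :: "(int ^ 'n) set"
  assumes finite_R: "finite R"
    and zero_notin_R: "0 \<notin> R"
    and facet: "r \<in> R \<Longrightarrow> \<exists>u. pairing u r = 0 \<and> (\<forall>s\<in>R - {r}. 0 < pairing u s)"
begin

text \<open>
  The lattice points of the dual cone.
\<close>
definition weights :: "(int ^ 'n) set" where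
  "weights = {m. \<forall>r\<in>R. 0 \<le> pairing m r}"

definition weight_algebra :: "(int ^ 'n \<Rightarrow>\<^sub>0 'k::field) set" where
  "weight_algebra = {f. Poly_Mapping.keys f \<subseteq> weights}"

definition is_root :: "int ^ 'n \<Rightarrow> int ^ 'n \<Rightarrow> bool" where
  "is_root v e \<longleftrightarrow> v \<in> R \<and> pairing e v = -1 \<and> (\<forall>s\<in>R - {v}. 0 \<le> pairing e s)"

lemma weights_zero: "0 \<in> weights" by (simp add: weights_def)

lemma weights_add: "m + m' \<in> weights" if "m \<in> weights" "m' \<in> weights"
  using that by (simp add: weights_def pairing_add_left)

lemma weight_algebra_zero [simp]: "0 \<in> weight_algebra"
  by (simp add: weight_algebra_def)

lemma weight_algebra_single [simp]:
  "Poly_Mapping.single m c \<in> weight_algebra" if "m \<in> weights"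
  using that by (simp add: weight_algebra_def)

lemma weight_algebra_add: "f + g \<in> weight_algebra" if "f \<in> weight_algebra" "g \<in> weight_algebra"
  using that Poly_Mapping.keys_add[of f g] by (auto simp: weight_algebra_def)

text \<open>
  Adding a large multiple of \<open>u\<close> repairs the negative values of \<open>x\<close>, provided that they occur only
  where \<open>u\<close> is positive. With \<open>u\<close> interior this shows that \<open>weights\<close> generates the lattice; with a
  facet form it shows the same for every facet.
\<close>
lemma absorb_into_weights:
  assumes "\<And>r. r \<in> R \<Longrightarrow> 0 \<le> pairing u r" and "\<And>r. r \<in> R \<Longrightarrow> pairing u r = 0 \<Longrightarrow> 0 \<le> pairing x r"
  obtains k where "0 < k" and "x + k *s u \<in> weights"
proof -
  have "finite {r \<in> R. 0 < pairing u r}" using finite_R by simp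
  then obtain k where k: "0 < k" "\<forall>r\<in>{r \<in> R. 0 < pairing u r}. 0 < k * pairing u r + pairing x r"
    using finite_int_mult_dominates[of "{r \<in> R. 0 < pairing u r}" "pairing u" "pairing x"] by blast
  have "0 \<le> pairing (x + k *s u) r" if r: "r \<in> R" for r
  proof (cases "pairing u r = 0")
    case True
    then show ?thesis using assms(2)[OF r] by (simp add: pairing_linear)
  next
    case False
    then have "0 < pairing u r" using assms(1)[OF r] by simp
    then have "0 < k * pairing u r + pairing x r" using k(2) r by blast
    then show ?thesis by (simp add: pairing_linear)
  qed
  then show ?thesis using that[of k] k(1) by (simp add: weights_def)
qed

text \<open>
  A facet form of one ray \<open>r\<close>, taken with a large multiple, plus \<open>r\<close> itself read as a form.
\<close>
lemma positive_form: obtains u where "\<And>r. r \<in> R \<Longrightarrow> 0 < pairing u r"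
proof (cases "R = {}")
  case True
  then show ?thesis using that by blast
next
  case False
  then obtain r where r: "r \<in> R" by blast
  then obtain u where u: "pairing u r = 0" "\<forall>s\<in>R - {r}. 0 < pairing u s" using facet by blast
  obtain k where k: "\<forall>s\<in>R - {r}. 0 < k * pairing u s + pairing r s"
    using finite_int_mult_dominates[of "R - {r}" "pairing u" "pairing r"] finite_R u(2) by blast
  have rr: "0 < pairing r r" using r zero_notin_R by (intro pairing_self_pos) auto
  have "0 < pairing (k *s u + r) s" if s: "s \<in> R" for s
  proof (cases "s = r")
    case True
    then show ?thesis using u(1) rr by (simp add: pairing_linear)
  next
    case False
    then have "0 < k * pairing u s + pairing r s" using k s by blast
    then show ?thesis by (simp add: pairing_linear)
  qed
  then show ?thesis using that by blast
qed

lemma weights_generate: obtains p q where "p \<in> weights" and "q \<in> weights" and "m = p - q"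
proof -
  obtain u where u: "\<And>r. r \<in> R \<Longrightarrow> 0 < pairing u r" using positive_form by blast
  obtain k where k: "0 < k" "m + k *s u \<in> weights"
    by (rule absorb_into_weights[of u m]) (use u in force)+
  have "k *s u \<in> weights" using k(1) u by (simp add: weights_def pairing_linear less_imp_le)
  then show ?thesis using that[of "m + k *s u" "k *s u"] k(2) by simp
qed

text \<open>
  The step \<open>m \<mapsto> m + e\<close> lowers only the value on \<open>v\<close>, by one, and it carries a zero coefficient
  where that value is already zero.
\<close>
lemma root_derivation_weight_algebra:
  assumes "is_root v e" and "f \<in> weight_algebra"
  shows "root_derivation v e f \<in> weight_algebra"
proof -
  have "\<mu> \<in> weights" if \<mu>: "\<mu> \<in> Poly_Mapping.keys (root_derivation v e f)" for \<mu>
  proof -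
    have "\<mu> - e \<in> Poly_Mapping.keys f" and ne: "pairing (\<mu> - e) v \<noteq> 0"
      using \<mu> by (auto simp: in_keys_iff lookup_root_derivation)
    then have *: "\<And>r. r \<in> R \<Longrightarrow> 0 \<le> pairing (\<mu> - e) r"
      using assms(2) by (auto simp: weight_algebra_def weights_def)
    have "0 \<le> pairing \<mu> r" if r: "r \<in> R" for r
    proof (cases "r = v")
      case True
      then show ?thesis using *[OF r] ne assms(1) by (simp add: is_root_def pairing_diff_left)
    next
      case False
      then have "0 \<le> pairing e r" using r assms(1) by (simp add: is_root_def)
      then show ?thesis using *[OF r] by (simp add: pairing_diff_left)
    qed
    then show ?thesis by (simp add: weights_def)
  qed
  then show ?thesis by (auto simp: weight_algebra_def)
qed

text \<open>
  Each application lowers the value of every exponent on \<open>v\<close> by one, and this value cannot become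
  negative.
\<close>
lemma lnd_root_derivation:
  assumes root: "is_root v e"
  shows "lnd_on weight_algebra (root_derivation v e :: (int ^ 'n \<Rightarrow>\<^sub>0 'k::field) \<Rightarrow> _)"
proof -
  have "\<exists>n. (root_derivation v e ^^ n) f = 0" if f: "f \<in> weight_algebra" for f :: "int ^ 'n \<Rightarrow>\<^sub>0 'k"
  proof -
    define N where "N = (\<Sum>m\<in>Poly_Mapping.keys f. \<bar>pairing m v\<bar>)"
    have bound: "(root_derivation v e ^^ n) f \<in> weight_algebra \<and>
      (\<forall>m\<in>Poly_Mapping.keys ((root_derivation v e ^^ n) f). pairing m v + int n \<le> N)" for n
    proof (induction n)
      case 0
      have "pairing m v \<le> N" if m: "m \<in> Poly_Mapping.keys f" for m
        using member_le_sum[OF m, of "\<lambda>m. \<bar>pairing m v\<bar>"] by (simp add: N_def)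
      then show ?case using f by simp
    next
      case (Suc n)
      let ?g = "(root_derivation v e ^^ n) f"
      have "pairing m v + int (Suc n) \<le> N" if "m \<in> Poly_Mapping.keys (root_derivation v e ?g)" for m
      proof -
        have "m - e \<in> Poly_Mapping.keys ?g" using that by (auto simp: in_keys_iff lookup_root_derivation)
        then have "pairing (m - e) v + int n \<le> N" using Suc by blast
        then show ?thesis using root by (simp add: is_root_def pairing_diff_left)
      qed
      then show ?case using Suc by (simp add: root_derivation_weight_algebra[OF root])
    qed
    define n where "n = nat (N + 1)"
    have "Poly_Mapping.keys ((root_derivation v e ^^ n) f) = {}"
    proof (rule ccontr)
      assume "Poly_Mapping.keys ((root_derivation v e ^^ n) f) \<noteq> {}"
      then obtain m where "m \<in> Poly_Mapping.keys ((root_derivation v e ^^ n) f)" by blast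
      then have "pairing m v + int n \<le> N" and "m \<in> weights"
        using bound[of n] by (auto simp: weight_algebra_def)
      moreover have "0 \<le> pairing m v" using root \<open>m \<in> weights\<close> by (simp add: weights_def is_root_def)
      ultimately show False by (simp add: n_def split: if_splits)
    qed
    then show ?thesis by (auto simp: keys_eq_empty)
  qed
  then show ?thesis
    unfolding lnd_on_def
    by (intro conjI ballI allI root_derivation_weight_algebra[OF root] root_derivation_add
        root_derivation_scale root_derivation_mult)
qed

end

section \<open>Homogeneous components of a derivation\<close>

context ray_system
begin

text \<open>
  The weights form a cancellative monoid whose group of differences is the whole lattice.
\<close>
lemma additive_extension:
  fixes h :: "int ^ 'n \<Rightarrow> 'k::ring_1"
  assumes h: "\<And>m m'. m \<in> weights \<Longrightarrow> m' \<in> weights \<Longrightarrow> h (m + m') = h m + h m'"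
  obtains g where "Modules.additive g" and "\<And>m. m \<in> weights \<Longrightarrow> g m = h m"
proof -
  have "\<exists>y. \<forall>p\<in>weights. \<forall>q\<in>weights. m = p - q \<longrightarrow> y = h p - h q" for m
  proof -
    obtain p q where pq: "p \<in> weights" "q \<in> weights" "m = p - q" by (rule weights_generate)
    have "h p - h q = h p' - h q'" if "p' \<in> weights" "q' \<in> weights" "m = p' - q'" for p' q'
    proof -
      have "p + q' = p' + q" using pq(3) that(3) by (simp add: algebra_simps)
      then have "h p + h q' = h p' + h q" using h pq(1,2) that(1,2) by metis
      then show ?thesis by (simp add: algebra_simps)
    qed
    then show ?thesis by blast
  qed
  then obtain g where g: "\<And>p q. p \<in> weights \<Longrightarrow> q \<in> weights \<Longrightarrow> g (p - q) = h p - h q"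
    by metis
  have "g (x + y) = g x + g y" for x y
  proof -
    obtain p q where x: "p \<in> weights" "q \<in> weights" "x = p - q" by (rule weights_generate)
    obtain p' q' where y: "p' \<in> weights" "q' \<in> weights" "y = p' - q'" by (rule weights_generate)
    have "x + y = (p + p') - (q + q')" unfolding x(3) y(3) by (simp add: algebra_simps)
    then have "g (x + y) = h (p + p') - h (q + q')"
      using g[OF weights_add[OF x(1) y(1)] weights_add[OF x(2) y(2)]] by simp
    also have "\<dots> = (h p - h q) + (h p' - h q')" using x y by (simp add: h)
    also have "\<dots> = g x + g y" using g[OF x(1,2)] g[OF y(1,2)] x(3) y(3) by simp
    finally show ?thesis .
  qed
  then have "Modules.additive g" by unfold_locales
  moreover have "g m = h m" if "m \<in> weights" for m
  proof -
    have "h 0 = 0" using h[OF weights_zero weights_zero] by simp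
    then show ?thesis using g[OF that weights_zero] by simp
  qed
  ultimately show ?thesis using that by blast
qed

lemma derivation_sum:
  assumes lnd: "lnd_on weight_algebra D"
    and "finite K" and "\<And>m. m \<in> K \<Longrightarrow> F m \<in> weight_algebra"
  shows "D (\<Sum>m\<in>K. F m) = (\<Sum>m\<in>K. D (F m)) \<and> (\<Sum>m\<in>K. F m) \<in> weight_algebra"
  using assms(2,3)
proof (induction K)
  case empty
  have "D (Poly_Mapping.single 0 0 * 0) = Poly_Mapping.single 0 0 * D 0"
    using lnd weight_algebra_zero unfolding lnd_on_def by blast
  then show ?case by simp
next
  case (insert m K)
  have "D (F m + (\<Sum>m\<in>K. F m)) = D (F m) + D (\<Sum>m\<in>K. F m)"
    using lnd insert unfolding lnd_on_def by blast
  then show ?case using insert by (simp add: weight_algebra_add)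
qed

text \<open>
  The expansion \<open>D \<chi>\<^sup>m = \<Sum>\<^sub>a \<omega>\<^sub>a(m) \<chi>\<^bsup>m+a\<^esup>\<close> into homogeneous components, stated for coefficients so
  that no sum over the infinitely many degrees \<open>a\<close> occurs.
\<close>
definition weight_expansion ::
  "((int ^ 'n \<Rightarrow>\<^sub>0 'k::field) \<Rightarrow> (int ^ 'n \<Rightarrow>\<^sub>0 'k)) \<Rightarrow> (int ^ 'n \<Rightarrow> int ^ 'n \<Rightarrow> 'k) \<Rightarrow> bool" where
  "weight_expansion D \<omega> \<longleftrightarrow>
     (\<forall>a. Modules.additive (\<omega> a)) \<and> finite {a. \<exists>m. \<omega> a m \<noteq> 0} \<and>
     (\<forall>f\<in>weight_algebra. D f \<in> weight_algebra \<and>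
       (\<forall>\<mu>. Poly_Mapping.lookup (D f) \<mu>
          = (\<Sum>m\<in>Poly_Mapping.keys f. Poly_Mapping.lookup f m * \<omega> (\<mu> - m) m)))"

text \<open>
  The coefficient of \<open>\<chi>\<^bsup>m+a\<^esup>\<close> in \<open>D \<chi>\<^sup>m\<close> is additive in \<open>m\<close> by the Leibniz rule, so it extends from
  the weights to the lattice. Only finitely many \<open>a\<close> occur, since an additive function is determined
  by the standard basis and each basis vector is a difference of two weights.
\<close>
lemma lnd_weight_expansion:
  fixes D :: "(int ^ 'n \<Rightarrow>\<^sub>0 'k::field) \<Rightarrow> (int ^ 'n \<Rightarrow>\<^sub>0 'k)"
  assumes lnd: "lnd_on weight_algebra D"
  shows "\<exists>\<omega>. weight_expansion D \<omega>"
proof -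
  let ?\<chi> = "\<lambda>m. Poly_Mapping.single m (1::'k)"
  define h where "h a m = Poly_Mapping.lookup (D (?\<chi> m)) (m + a)" for a m
  have h_add: "h a (m + m') = h a m + h a m'" if m: "m \<in> weights" "m' \<in> weights" for a m m'
  proof -
    have "D (?\<chi> m * ?\<chi> m') = D (?\<chi> m) * ?\<chi> m' + ?\<chi> m * D (?\<chi> m')"
      using lnd m weight_algebra_single unfolding lnd_on_def by blast
    then have D: "D (?\<chi> (m + m')) = D (?\<chi> m) * ?\<chi> m' + D (?\<chi> m') * ?\<chi> m"
      by (simp add: mult_single ac_simps)
    have "m + m' + a - m' = m + a" "m + m' + a - m = m' + a" by (simp_all add: algebra_simps)
    then show ?thesis by (simp add: h_def D lookup_add lookup_times_single)
  qed
  have "\<exists>g. Modules.additive g \<and> (\<forall>m\<in>weights. g m = h a m)" for a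
    using additive_extension[of "h a"] h_add by metis
  then obtain \<omega> where add: "\<And>a. Modules.additive (\<omega> a)"
    and \<omega>: "\<And>a m. m \<in> weights \<Longrightarrow> \<omega> a m = h a m" by metis
  have h_fin: "finite {a. h a m \<noteq> 0}" for m
  proof -
    have "a \<in> (\<lambda>\<mu>. \<mu> - m) ` Poly_Mapping.keys (D (?\<chi> m))" if "h a m \<noteq> 0" for a
      using that by (intro image_eqI[of _ _ "m + a"]) (simp_all add: h_def in_keys_iff)
    then have "{a. h a m \<noteq> 0} \<subseteq> (\<lambda>\<mu>. \<mu> - m) ` Poly_Mapping.keys (D (?\<chi> m))" by blast
    then show ?thesis by (rule finite_subset) simp
  qed
  have "\<exists>p q. p \<in> weights \<and> q \<in> weights \<and> axis i 1 = p - q" for i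
    by (rule weights_generate[of "axis i 1"]) blast
  then obtain p q where pq: "\<And>i. p i \<in> weights" "\<And>i. q i \<in> weights" "\<And>i. axis i 1 = p i - q i"
    by metis
  have "{a. \<exists>m. \<omega> a m \<noteq> 0} \<subseteq> (\<Union>i. {a. h a (p i) \<noteq> 0} \<union> {a. h a (q i) \<noteq> 0})"
  proof (rule subsetI, rule ccontr)
    fix a assume a: "a \<in> {a. \<exists>m. \<omega> a m \<noteq> 0}"
      "a \<notin> (\<Union>i. {a. h a (p i) \<noteq> 0} \<union> {a. h a (q i) \<noteq> 0})"
    have "\<omega> a (axis i 1) = 0" for i
      unfolding pq(3) using a(2) by (simp add: Modules.additive.diff[OF add] \<omega> pq(1,2))
    then show False using additive_eq_0_on_axes[OF add] a(1) by blast
  qed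
  moreover have "finite (\<Union>i. {a. h a (p i) \<noteq> 0} \<union> {a. h a (q i) \<noteq> 0})"
    by (simp add: h_fin)
  ultimately have fin: "finite {a. \<exists>m. \<omega> a m \<noteq> 0}" by (rule finite_subset)
  have expand: "Poly_Mapping.lookup (D f) \<mu>
      = (\<Sum>m\<in>Poly_Mapping.keys f. Poly_Mapping.lookup f m * \<omega> (\<mu> - m) m)"
    if f: "f \<in> weight_algebra" for f \<mu>
  proof -
    have K: "m \<in> weights" if "m \<in> Poly_Mapping.keys f" for m
      using f that by (auto simp: weight_algebra_def)
    have single: "D (Poly_Mapping.single m c) = Poly_Mapping.single 0 c * D (?\<chi> m)"
      if "m \<in> weights" for m c
    proof -
      have "D (Poly_Mapping.single 0 c * ?\<chi> m) = Poly_Mapping.single 0 c * D (?\<chi> m)"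
        using lnd weight_algebra_single[OF that] unfolding lnd_on_def by blast
      then show ?thesis by (simp add: mult_single)
    qed
    have "D f = (\<Sum>m\<in>Poly_Mapping.keys f. D (Poly_Mapping.single m (Poly_Mapping.lookup f m)))"
      using derivation_sum[OF lnd, of "Poly_Mapping.keys f" "\<lambda>m. Poly_Mapping.single m (Poly_Mapping.lookup f m)"]
      by (simp add: K sum_single_keys[symmetric])
    also have "\<dots> = (\<Sum>m\<in>Poly_Mapping.keys f. D (?\<chi> m) * Poly_Mapping.single 0 (Poly_Mapping.lookup f m))"
    proof (rule sum.cong[OF refl])
      fix m assume "m \<in> Poly_Mapping.keys f"
      then show "D (Poly_Mapping.single m (Poly_Mapping.lookup f m))
          = D (?\<chi> m) * Poly_Mapping.single 0 (Poly_Mapping.lookup f m)"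
        by (subst single[OF K]) (auto intro: mult.commute)
    qed
    finally show ?thesis
      by (simp add: lookup_sum lookup_times_single \<omega> K h_def mult.commute)
  qed
  show ?thesis
    unfolding weight_expansion_def using add fin expand lnd
    by (intro exI[of _ \<omega>]) (simp add: lnd_on_def)
qed

lemma weight_expansion_single:
  assumes "weight_expansion D \<omega>" and "m \<in> weights"
  shows "Poly_Mapping.lookup (D (Poly_Mapping.single m 1)) \<mu> = \<omega> (\<mu> - m) m"
  using assms by (simp add: weight_expansion_def)

lemma weight_expansion_shift:
  assumes D: "weight_expansion D \<omega>" and m: "m \<in> weights" and "\<omega> a m \<noteq> 0"
  shows "m + a \<in> weights"
proof -
  have "D (Poly_Mapping.single m 1) \<in> weight_algebra"
    using D m by (simp add: weight_expansion_def)
  moreover have "m + a \<in> Poly_Mapping.keys (D (Poly_Mapping.single m 1))"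
    using assms by (simp add: in_keys_iff weight_expansion_single)
  ultimately show ?thesis by (auto simp: weight_algebra_def)
qed

text \<open>
  For a weight \<open>m\<close> this is the comparison of the coefficients of \<open>\<chi>\<^bsup>m+e+a\<^esup>\<close> in \<open>\<delta>\<^sub>e D \<chi>\<^sup>m\<close> and
  \<open>D \<delta>\<^sub>e \<chi>\<^sup>m\<close>. Both sides are additive in \<open>m\<close>, so the identity extends to the lattice.
\<close>
lemma commuting_weights:
  fixes D :: "(int ^ 'n \<Rightarrow>\<^sub>0 'k::field) \<Rightarrow> (int ^ 'n \<Rightarrow>\<^sub>0 'k)"
  assumes D: "weight_expansion D \<omega>" and root: "is_root v e"
    and comm: "commute_on weight_algebra (root_derivation v e) D"
  shows "of_int (pairing m v) * \<omega> a e = of_int (pairing a v) * \<omega> a m"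
proof -
  interpret \<omega>: Modules.additive "\<omega> a" using D by (simp add: weight_expansion_def)
  have weights_case: "of_int (pairing m v) * \<omega> a e = of_int (pairing a v) * \<omega> a m"
    if m: "m \<in> weights" for m
  proof -
    let ?\<chi> = "Poly_Mapping.single m (1::'k)"
    let ?x = "of_int (pairing m v) :: 'k"
    have "root_derivation v e (D ?\<chi>) = D (root_derivation v e ?\<chi>)"
      using comm weight_algebra_single[OF m] unfolding commute_on_def by blast
    then have "Poly_Mapping.lookup (root_derivation v e (D ?\<chi>)) (m + e + a)
        = Poly_Mapping.lookup (D (root_derivation v e ?\<chi>)) (m + e + a)" by simp
    moreover have "Poly_Mapping.lookup (root_derivation v e (D ?\<chi>)) (m + e + a)
        = \<omega> a m * of_int (pairing (m + a) v)"
    proof -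
      have "m + e + a - e = m + a" by simp
      then show ?thesis by (simp add: lookup_root_derivation weight_expansion_single[OF D m])
    qed
    moreover have "Poly_Mapping.lookup (D (root_derivation v e ?\<chi>)) (m + e + a) = ?x * \<omega> a (m + e)"
    proof -
      have "root_derivation v e ?\<chi> \<in> weight_algebra"
        using root m by (simp add: root_derivation_weight_algebra)
      then show ?thesis
        using D by (cases "?x = 0") (simp_all add: weight_expansion_def root_derivation_single)
    qed
    ultimately have "\<omega> a m * of_int (pairing (m + a) v) = ?x * \<omega> a (m + e)" by simp
    then show ?thesis by (simp add: \<omega>.add pairing_add_left algebra_simps)
  qed
  obtain p q where pq: "p \<in> weights" "q \<in> weights" "m = p - q" by (rule weights_generate)
  show ?thesis
    using weights_case[OF pq(1)] weights_case[OF pq(2)]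
    by (simp add: pq(3) \<omega>.diff pairing_diff_left left_diff_distrib right_diff_distrib)
qed

end

section \<open>Derivations commuting with a root derivation\<close>

lemma unique_maximizer:
  fixes g :: "'b \<Rightarrow> 'c::linorder"
  assumes "finite K" and "K \<noteq> {}" and "inj_on g K"
  obtains x where "x \<in> K" and "\<And>y. y \<in> K \<Longrightarrow> y \<noteq> x \<Longrightarrow> g y < g x"
proof -
  have "Max (g ` K) \<in> g ` K" using assms by (intro Max_in) auto
  then obtain x where x: "x \<in> K" "g x = Max (g ` K)" by force
  have "g y < g x" if "y \<in> K" "y \<noteq> x" for y
  proof -
    have "g y \<le> g x" using x(2) that(1) assms(1) by simp
    moreover have "g y \<noteq> g x" using assms(3) that x(1) by (auto dest: inj_onD)
    ultimately show ?thesis by simp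
  qed
  with x(1) show ?thesis using that by blast
qed

context ray_system
begin

text \<open>
  Putting \<open>m = e\<close> in the commutation identity gives \<open>(\<langle>a, v\<rangle> + 1) \<omega>\<^sub>a(e) = 0\<close>.
\<close>
lemma commuting_degree_cases:
  fixes D :: "(int ^ 'n \<Rightarrow>\<^sub>0 'k::field_char_0) \<Rightarrow> (int ^ 'n \<Rightarrow>\<^sub>0 'k)"
  assumes D: "weight_expansion D \<omega>" and root: "is_root v e"
    and comm: "commute_on weight_algebra (root_derivation v e) D"
    and ne: "\<omega> a m0 \<noteq> 0"
  shows "pairing a v = 0 \<and> \<omega> a e = 0 \<or>
    pairing a v = -1 \<and> (\<forall>m. \<omega> a m = - \<omega> a e * of_int (pairing m v))"
proof -
  note * = commuting_weights[OF D root comm, where a = a]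
  have ev: "pairing e v = -1" using root by (simp add: is_root_def)
  show ?thesis
  proof (cases "pairing a v = 0")
    case True
    then show ?thesis using *[of e] ev by simp
  next
    case False
    have "\<omega> a e \<noteq> 0" using *[of m0] False ne by auto
    have "of_int (pairing a v) * \<omega> a e = - \<omega> a e" using *[of e] by (simp add: ev)
    then have "of_int (pairing a v + 1) * \<omega> a e = 0" by (simp add: distrib_right)
    then have "(of_int (pairing a v + 1) :: 'k) = 0" using \<open>\<omega> a e \<noteq> 0\<close> by (metis mult_eq_0_iff)
    then have "pairing a v + 1 = 0" by (simp only: of_int_eq_0_iff)
    then have av: "pairing a v = -1" by linarith
    moreover have "\<omega> a m = - \<omega> a e * of_int (pairing m v)" for m
      using *[of m] by (simp add: av mult.commute)
    ultimately show ?thesis by blast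
  qed
qed

text \<open>
  Under the hypothesis \<open>D\<close> is \<open>\<delta>\<close> multiplied by the Laurent polynomial \<open>\<Sum> c\<^sub>a \<chi>\<^bsup>a-e\<^esup>\<close>. That such
  a product vanishes only with one of its factors is seen on the leading terms for an injective
  form.
\<close>
lemma kernel_eq_of_proportional:
  fixes D :: "(int ^ 'n \<Rightarrow>\<^sub>0 'k::field_char_0) \<Rightarrow> (int ^ 'n \<Rightarrow>\<^sub>0 'k)"
  assumes D: "weight_expansion D \<omega>" and nz: "nonzero_on weight_algebra D"
    and c: "\<And>a m. \<omega> a m = c a * of_int (pairing m v)"
  shows "kernel_on weight_algebra D = kernel_on weight_algebra (root_derivation v e)"
proof -
  have lookup_D: "Poly_Mapping.lookup (D f) \<mu> = (\<Sum>m\<in>Poly_Mapping.keys f.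
      Poly_Mapping.lookup f m * (c (\<mu> - m) * of_int (pairing m v)))"
    if "f \<in> weight_algebra" for f \<mu>
    using D that by (simp add: weight_expansion_def c)
  have root_zero: "root_derivation v e f = 0 \<longleftrightarrow> (\<forall>m\<in>Poly_Mapping.keys f. pairing m v = 0)"
    for f :: "int ^ 'n \<Rightarrow>\<^sub>0 'k"
  proof
    assume 0: "root_derivation v e f = 0"
    show "\<forall>m\<in>Poly_Mapping.keys f. pairing m v = 0"
    proof
      fix m assume "m \<in> Poly_Mapping.keys f"
      moreover have "Poly_Mapping.lookup (root_derivation v e f) (m + e) = 0" using 0 by simp
      ultimately show "pairing m v = 0" by (simp add: lookup_root_derivation in_keys_iff)
    qed
  next
    assume "\<forall>m\<in>Poly_Mapping.keys f. pairing m v = 0"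
    then show "root_derivation v e f = 0" by (simp add: root_derivation_def)
  qed
  have D_zero: "D f = 0 \<longleftrightarrow> (\<forall>m\<in>Poly_Mapping.keys f. pairing m v = 0)"
    if f: "f \<in> weight_algebra" for f
  proof
    assume "\<forall>m\<in>Poly_Mapping.keys f. pairing m v = 0"
    then show "D f = 0" by (intro poly_mapping_eqI) (simp add: lookup_D[OF f])
  next
    assume D0: "D f = 0"
    show "\<forall>m\<in>Poly_Mapping.keys f. pairing m v = 0"
    proof (rule ccontr)
      let ?K = "{m \<in> Poly_Mapping.keys f. pairing m v \<noteq> 0}"
      let ?F = "{a. c a \<noteq> 0}"
      assume "\<not> (\<forall>m\<in>Poly_Mapping.keys f. pairing m v = 0)"
      then have K: "?K \<noteq> {}" "finite ?K" by auto
      then obtain m0 where m0: "pairing m0 v \<noteq> 0" by blast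
      have "?F \<subseteq> {a. \<exists>m. \<omega> a m \<noteq> 0}" using m0 by (auto simp: c)
      then have fin: "finite ?F" using D by (auto simp: weight_expansion_def intro: finite_subset)
      have F: "?F \<noteq> {}"
      proof
        assume "?F = {}"
        then have "D g = 0" if "g \<in> weight_algebra" for g
          using that by (intro poly_mapping_eqI) (simp add: lookup_D)
        then show False using nz by (auto simp: nonzero_on_def)
      qed
      obtain l where l: "inj_on (\<lambda>m. pairing m l) (?K \<union> ?F)"
        using injective_form[of "?K \<union> ?F"] K(2) fin by blast
      have inj: "inj_on (\<lambda>m. pairing m l) ?K" "inj_on (\<lambda>m. pairing m l) ?F"
        using inj_on_subset[OF l] by blast+
      obtain m1 where m1: "m1 \<in> ?K" "\<And>m. m \<in> ?K \<Longrightarrow> m \<noteq> m1 \<Longrightarrow> pairing m l < pairing m1 l"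
        by (rule unique_maximizer[OF K(2,1) inj(1)]) blast
      obtain a1 where a1: "a1 \<in> ?F" "\<And>a. a \<in> ?F \<Longrightarrow> a \<noteq> a1 \<Longrightarrow> pairing a l < pairing a1 l"
        by (rule unique_maximizer[OF fin F inj(2)]) blast
      have "Poly_Mapping.lookup f m * (c (m1 + a1 - m) * of_int (pairing m v)) = 0"
        if m: "m \<in> Poly_Mapping.keys f - {m1}" for m
      proof (rule ccontr)
        assume "Poly_Mapping.lookup f m * (c (m1 + a1 - m) * of_int (pairing m v)) \<noteq> 0"
        then have "m \<in> ?K" "m1 + a1 - m \<in> ?F" using m by auto
        then have "pairing m l < pairing m1 l" and "pairing (m1 + a1 - m) l \<le> pairing a1 l"
          using m1(2)[of m] a1(2)[of "m1 + a1 - m"] m by fastforce+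
        then show False by (simp add: pairing_linear)
      qed
      then have "(\<Sum>m\<in>Poly_Mapping.keys f - {m1}.
          Poly_Mapping.lookup f m * (c (m1 + a1 - m) * of_int (pairing m v))) = 0"
        by (rule sum.neutral[OF ballI])
      then have "Poly_Mapping.lookup (D f) (m1 + a1)
          = Poly_Mapping.lookup f m1 * (c (m1 + a1 - m1) * of_int (pairing m1 v))"
        using m1(1) by (simp add: lookup_D[OF f] sum.remove[of _ m1])
      then show False using m1(1) a1(1) D0 by (auto simp: in_keys_iff)
    qed
  qed
  show ?thesis using D_zero root_zero by (auto simp: kernel_on_def)
qed

text \<open>
  If \<open>\<omega>\<^sub>a\<close> vanished nowhere along \<open>m, m + a, m + 2a, \<dots>\<close>, then \<open>m + na\<close> would be the leading
  exponent of \<open>D\<^sup>n \<chi>\<^sup>m\<close> for every \<open>n\<close>, contradicting local nilpotency.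
\<close>
lemma dominant_degree_nilpotent:
  fixes D :: "(int ^ 'n \<Rightarrow>\<^sub>0 'k::field) \<Rightarrow> (int ^ 'n \<Rightarrow>\<^sub>0 'k)"
  assumes D: "weight_expansion D \<omega>" and lnd: "lnd_on weight_algebra D"
    and dom: "\<And>b x. \<omega> b x \<noteq> 0 \<Longrightarrow> b \<noteq> a \<Longrightarrow> pairing b l < pairing a l"
    and m: "m \<in> weights"
  shows "\<exists>k. \<omega> a (m + int k *s a) = 0"
proof (rule ccontr)
  assume "\<not> (\<exists>k. \<omega> a (m + int k *s a) = 0)"
  then have ne: "\<omega> a (m + int k *s a) \<noteq> 0" for k by blast
  define g where "g n = (D ^^ n) (Poly_Mapping.single m 1)" for n
  have top: "g n \<in> weight_algebra \<and> m + int n *s a \<in> Poly_Mapping.keys (g n) \<and>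
    (\<forall>x\<in>Poly_Mapping.keys (g n). x \<noteq> m + int n *s a \<longrightarrow> pairing x l < pairing (m + int n *s a) l)" for n
  proof (induction n)
    case 0
    then show ?case using m by (simp add: g_def)
  next
    case (Suc n)
    define t where "t = m + int n *s a"
    have gn: "g n \<in> weight_algebra" and t: "t \<in> Poly_Mapping.keys (g n)"
      and lt: "\<And>x. x \<in> Poly_Mapping.keys (g n) \<Longrightarrow> x \<noteq> t \<Longrightarrow> pairing x l < pairing t l"
      using Suc by (auto simp: t_def)
    have Dg: "g (Suc n) = D (g n)" by (simp add: g_def)
    have t': "m + int (Suc n) *s a = t + a" by (simp add: t_def vec.scale_left_distrib add_ac)
    have lookup_D: "Poly_Mapping.lookup (D (g n)) \<mu>
        = (\<Sum>x\<in>Poly_Mapping.keys (g n). Poly_Mapping.lookup (g n) x * \<omega> (\<mu> - x) x)" for \<mu>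
      using D gn by (simp add: weight_expansion_def)
    have step: "pairing \<mu> l < pairing (t + a) l"
      if x: "x \<in> Poly_Mapping.keys (g n)" "\<omega> (\<mu> - x) x \<noteq> 0" "\<not> (x = t \<and> \<mu> = t + a)" for \<mu> x
    proof -
      have "pairing \<mu> l = pairing x l + pairing (\<mu> - x) l" by (simp add: pairing_linear)
      moreover have "x \<noteq> t \<Longrightarrow> pairing x l < pairing t l" using lt x(1) by blast
      moreover have "\<mu> - x \<noteq> a \<Longrightarrow> pairing (\<mu> - x) l < pairing a l" using dom x(2) by blast
      moreover have "x \<noteq> t \<or> \<mu> - x \<noteq> a" using x(3) by (auto simp: algebra_simps)
      moreover have "pairing (t + a) l = pairing t l + pairing a l" by (simp add: pairing_linear)
      ultimately show ?thesis by (cases "x = t"; cases "\<mu> - x = a") auto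
    qed
    have "Poly_Mapping.lookup (g n) x * \<omega> (t + a - x) x = 0"
      if x: "x \<in> Poly_Mapping.keys (g n) - {t}" for x
      using step[of x "t + a"] x by fastforce
    then have "(\<Sum>x\<in>Poly_Mapping.keys (g n) - {t}. Poly_Mapping.lookup (g n) x * \<omega> (t + a - x) x) = 0"
      by (rule sum.neutral[OF ballI])
    then have "Poly_Mapping.lookup (D (g n)) (t + a) = Poly_Mapping.lookup (g n) t * \<omega> (t + a - t) t"
      using t by (simp add: lookup_D sum.remove[of _ t])
    then have "t + a \<in> Poly_Mapping.keys (D (g n))"
      using t ne[of n] by (simp add: in_keys_iff t_def)
    moreover have "pairing \<mu> l < pairing (t + a) l"
      if \<mu>: "\<mu> \<in> Poly_Mapping.keys (D (g n))" "\<mu> \<noteq> t + a" for \<mu>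
    proof -
      have "\<exists>x\<in>Poly_Mapping.keys (g n). Poly_Mapping.lookup (g n) x * \<omega> (\<mu> - x) x \<noteq> 0"
      proof (rule ccontr)
        assume "\<not> ?thesis"
        then have "Poly_Mapping.lookup (D (g n)) \<mu> = 0"
          unfolding lookup_D by (intro sum.neutral) blast
        then show False using \<mu>(1) by (simp add: in_keys_iff)
      qed
      then obtain x where "x \<in> Poly_Mapping.keys (g n)" "\<omega> (\<mu> - x) x \<noteq> 0" by force
      then show ?thesis using step[of x \<mu>] \<mu>(2) by blast
    qed
    moreover have "D (g n) \<in> weight_algebra" using D gn by (simp add: weight_expansion_def)
    ultimately show ?case unfolding Dg t' by blast
  qed
  have "g n \<noteq> 0" for n using top[of n] by auto
  moreover have "\<exists>n. g n = 0" using lnd weight_algebra_single[OF m] unfolding lnd_on_def g_def by blast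
  ultimately show False by blast
qed

text \<open>
  The weights on the facet of \<open>r\<close> generate the hyperplane orthogonal to \<open>r\<close>, so \<open>w\<close> vanishes on
  that hyperplane; the conclusion says, without division, that \<open>w\<close> is a multiple of \<open>\<langle>_, r\<rangle>\<close>.
\<close>
lemma vanishing_on_facet:
  fixes w :: "int ^ 'n \<Rightarrow> 'k::ring_1"
  assumes w: "Modules.additive w" and r: "r \<in> R"
    and van: "\<And>m. m \<in> weights \<Longrightarrow> pairing m r = 0 \<Longrightarrow> w m = 0"
  shows "of_int (pairing x r) * w y = of_int (pairing y r) * w x"
proof -
  interpret w: Modules.additive w by (rule w)
  obtain u where u: "pairing u r = 0" "\<forall>s\<in>R - {r}. 0 < pairing u s" using facet[OF r] by blast
  have u_nonneg: "0 \<le> pairing u s" if "s \<in> R" for s using u that by (cases "s = r") (auto simp: less_imp_le)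
  \<comment> \<open>This combination is orthogonal to \<open>r\<close>, and a multiple of \<open>u\<close> moves it into the facet of \<open>r\<close>.\<close>
  define z where "z = pairing x r *s y - pairing y r *s x"
  have zr: "pairing z r = 0" by (simp add: z_def pairing_linear)
  have z_nonneg: "0 \<le> pairing z s" if "s \<in> R" "pairing u s = 0" for s
  proof -
    have "s = r" using u(2) that by (metis DiffI less_irrefl singletonD)
    then show ?thesis using zr by simp
  qed
  obtain k where k: "z + k *s u \<in> weights"
    by (rule absorb_into_weights[of u z, OF u_nonneg z_nonneg])
  have "w (z + k *s u) = 0" using van[OF k] zr u(1) by (simp add: pairing_linear)
  moreover have "w u = 0" using van[of u] u(1) u_nonneg by (simp add: weights_def)
  ultimately have "w z = 0" by (simp add: w.add additive_int_scale[OF w])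
  then show ?thesis by (simp add: z_def w.diff additive_int_scale[OF w])
qed

text \<open>
  The degree \<open>a\<close> is negative on some ray: otherwise \<open>a\<close> is itself a weight, nilpotency at
  \<open>a\<close> gives \<open>w(a) = 0\<close>, and then nilpotency at any weight \<open>m\<close> gives \<open>w(m) = 0\<close>. If \<open>a\<close> is negative
  on \<open>r\<close>, then \<open>m + a\<close> is not a weight for \<open>m\<close> on the facet of \<open>r\<close>, so \<open>w\<close> vanishes on this facet.
  A second such ray is impossible, because \<open>w\<close> would be a multiple of two independent forms.
\<close>
lemma homogeneous_lnd_ray:
  fixes w :: "int ^ 'n \<Rightarrow> 'k::field_char_0"
  assumes w: "Modules.additive w" and nz: "w m0 \<noteq> 0"
    and shift: "\<And>m. m \<in> weights \<Longrightarrow> w m \<noteq> 0 \<Longrightarrow> m + a \<in> weights"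
    and nil: "\<And>m. m \<in> weights \<Longrightarrow> \<exists>k. w (m + int k *s a) = 0"
  obtains r where "r \<in> R" and "pairing a r < 0" and "\<And>s. s \<in> R - {r} \<Longrightarrow> 0 \<le> pairing a s"
    and "\<And>x y. of_int (pairing x r) * w y = of_int (pairing y r) * w x"
proof -
  interpret w: Modules.additive w by (rule w)
  note w_simps = w.add additive_int_scale[OF w]
  have "a \<notin> weights"
  proof
    assume a: "a \<in> weights"
    obtain k where "w (a + int k *s a) = 0" using nil[OF a] by blast
    then have "of_nat (Suc k) * w a = 0" by (simp add: w_simps distrib_right)
    then have wa: "w a = 0" by (simp only: mult_eq_0_iff of_nat_eq_0_iff) simp
    have "w m = 0" if "m \<in> weights" for m
      using nil[OF that] wa by (simp add: w_simps)
    moreover obtain p q where "p \<in> weights" "q \<in> weights" "m0 = p - q" by (rule weights_generate)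
    ultimately show False using nz by (simp add: w.diff)
  qed
  then obtain r where r: "r \<in> R" "pairing a r < 0" by (auto simp: weights_def not_le)
  have rigid: "of_int (pairing x s) * w y = of_int (pairing y s) * w x"
    if s: "s \<in> R" "pairing a s < 0" for s x y
  proof (rule vanishing_on_facet[OF w s(1)])
    fix m assume m: "m \<in> weights" "pairing m s = 0"
    show "w m = 0"
    proof (rule ccontr)
      assume "w m \<noteq> 0"
      then have "0 \<le> pairing (m + a) s" using shift[OF m(1)] s(1) by (simp add: weights_def)
      then show False using m(2) s(2) by (simp add: pairing_linear)
    qed
  qed
  have "0 \<le> pairing a s" if s: "s \<in> R - {r}" for s
  proof (rule ccontr)
    assume "\<not> 0 \<le> pairing a s"
    then have as: "pairing a s < 0" by simp
    obtain u where u: "pairing u r = 0" "0 < pairing u s" using facet[OF r(1)] s by blast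
    have "w u = 0" using rigid[OF r, of a u] r(2) u(1) by simp
    moreover have "of_int (pairing u s) * w m0 = of_int (pairing m0 s) * w u"
      using rigid[of s] s as by blast
    ultimately show False using u(2) nz by simp
  qed
  with r rigid[OF r] show ?thesis using that by blast
qed

text \<open>
  Some degree of \<open>D\<close> is orthogonal to \<open>v\<close>, since otherwise the kernels agree. Among these degrees
  let \<open>a\<close> be the maximum for an injective form; adding a large multiple of \<open>v\<close> to the form makes
  \<open>a\<close> dominate all degrees of \<open>D\<close>, as the remaining ones have value \<open>-1\<close> on \<open>v\<close>.
\<close>
lemma commuting_inequivalent_lnd:
  fixes D :: "(int ^ 'n \<Rightarrow>\<^sub>0 'k::field_char_0) \<Rightarrow> (int ^ 'n \<Rightarrow>\<^sub>0 'k)"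
  assumes root: "is_root v e" and lnd: "lnd_on weight_algebra D" and nz: "nonzero_on weight_algebra D"
    and comm: "commute_on weight_algebra (root_derivation v e) D"
    and ineq: "\<not> equivalent_on weight_algebra D (root_derivation v e)"
  obtains r where "r \<in> R - {v}" and "pairing e r = 0" and "exposed_pair R v r"
proof -
  obtain \<omega> where D: "weight_expansion D \<omega>" using lnd_weight_expansion[OF lnd] by blast
  have add: "Modules.additive (\<omega> a)" for a using D by (simp add: weight_expansion_def)
  note dichotomy = commuting_degree_cases[OF D root comm]
  have v: "v \<in> R" and ev: "pairing e v = -1" and e_nonneg: "\<And>s. s \<in> R - {v} \<Longrightarrow> 0 \<le> pairing e s"
    using root by (auto simp: is_root_def)
  define F where "F = {a. \<exists>m. \<omega> a m \<noteq> 0}"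
  have fin: "finite F" using D by (simp add: F_def weight_expansion_def)
  define F0 where "F0 = {a \<in> F. pairing a v = 0}"
  have "F0 \<noteq> {}"
  proof
    assume F0: "F0 = {}"
    have "\<omega> a m = - \<omega> a e * of_int (pairing m v)" for a m
    proof (cases "a \<in> F")
      case True
      then obtain m' where "\<omega> a m' \<noteq> 0" by (auto simp: F_def)
      moreover have "pairing a v \<noteq> 0" using True F0 unfolding F0_def by blast
      ultimately show ?thesis using dichotomy[of a m'] by blast
    qed (simp add: F_def)
    then have "equivalent_on weight_algebra D (root_derivation v e)"
      unfolding equivalent_on_def by (rule kernel_eq_of_proportional[OF D nz])
    then show False using ineq by blast
  qed
  obtain l where l: "inj_on (\<lambda>m. pairing m l) F" using injective_form[OF fin] by blast
  have inj0: "inj_on (\<lambda>m. pairing m l) F0" using inj_on_subset[OF l] by (auto simp: F0_def)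
  have fin0: "finite F0" using fin by (simp add: F0_def)
  obtain a where a: "a \<in> F0" "\<And>b. b \<in> F0 \<Longrightarrow> b \<noteq> a \<Longrightarrow> pairing b l < pairing a l"
    by (rule unique_maximizer[OF fin0 \<open>F0 \<noteq> {}\<close> inj0]) blast
  obtain k where k: "\<forall>b\<in>F. 0 < k * (1::int) + (pairing a l - pairing b l)"
    using finite_int_mult_dominates[OF fin, of "\<lambda>_. 1" "\<lambda>b. pairing a l - pairing b l"] by auto
  \<comment> \<open>The form \<open>l + k v\<close> agrees with \<open>l\<close> on degrees orthogonal to \<open>v\<close> and lowers the others by \<open>k\<close>.\<close>
  have dom: "pairing b (l + k *s v) < pairing a (l + k *s v)" if b: "\<omega> b x \<noteq> 0" "b \<noteq> a" for b x
  proof -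
    have av: "pairing a v = 0" using a(1) by (simp add: F0_def)
    have bF: "b \<in> F" using b(1) by (auto simp: F_def)
    from dichotomy[OF b(1)] show ?thesis
    proof
      assume "pairing b v = 0 \<and> \<omega> b e = 0"
      then show ?thesis using a(2)[of b] b(2) bF av by (simp add: F0_def pairing_linear)
    next
      assume "pairing b v = -1 \<and> (\<forall>m. \<omega> b m = - \<omega> b e * of_int (pairing m v))"
      then show ?thesis using k bF av by (auto simp: pairing_linear)
    qed
  qed
  obtain m0 where m0: "\<omega> a m0 \<noteq> 0" using a(1) by (auto simp: F0_def F_def)
  have av: "pairing a v = 0" and ae: "\<omega> a e = 0"
    using a(1) dichotomy[OF m0] by (auto simp: F0_def)
  obtain r where r: "r \<in> R" "pairing a r < 0" and a_nonneg: "\<And>s. s \<in> R - {r} \<Longrightarrow> 0 \<le> pairing a s"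
    and rigid: "\<And>x y. of_int (pairing x r) * \<omega> a y = of_int (pairing y r) * \<omega> a x"
    by (rule homogeneous_lnd_ray[OF add[of a] m0 weight_expansion_shift[OF D]
        dominant_degree_nilpotent[OF D lnd dom]]) blast+
  have "r \<noteq> v" using av r(2) by auto
  have er: "pairing e r = 0" using rigid[of e m0] ae m0 by simp
  obtain p where p: "\<And>s. s \<in> R \<Longrightarrow> 0 < pairing p s" using positive_form by blast
  define t where "t = - pairing a r"
  \<comment> \<open>On \<open>v\<close> only the first two terms count and cancel, on \<open>r\<close> only the first and the third.
    On every other ray the first term is positive and the other two are nonnegative.\<close>
  define u where "u = t *s p + (t * pairing p v) *s e + pairing p r *s a"
  have pu: "pairing u s = t * pairing p s + t * pairing p v * pairing e s + pairing p r * pairing a s" for s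
    by (simp add: u_def pairing_linear)
  have "pairing u v = 0" "pairing u r = 0" by (simp_all add: pu ev av er t_def)
  moreover have "0 < pairing u s" if s: "s \<in> R - {v, r}" for s
  proof -
    have "0 < t * pairing p s" using r(2) p s by (simp add: t_def mult_neg_pos)
    moreover have "0 \<le> t * pairing p v * pairing e s"
      using r(2) p[OF v] e_nonneg[of s] s by (simp add: t_def mult_nonpos_nonneg)
    moreover have "0 \<le> pairing p r * pairing a s"
      using p[OF r(1)] a_nonneg[of s] s by simp
    ultimately show ?thesis by (simp add: pu)
  qed
  ultimately have "exposed_pair R v r" by (auto simp: exposed_pair_def)
  with r(1) \<open>r \<noteq> v\<close> er show ?thesis using that by blast
qed

end

section \<open>Maximality of root derivations\<close>

text \<open>
  Bezout: the least positive value \<open>d\<close> of the pairing with \<open>v\<close> divides every coordinate of \<open>v\<close>.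
\<close>
lemma primitive_vector_pairing_one:
  assumes "primitive_vector v"
  obtains c where "pairing c v = 1"
proof -
  let ?Q = "\<lambda>d. 0 < d \<and> (\<exists>c. pairing c v = int d)"
  have "v \<noteq> 0" using assms by (simp add: primitive_vector_def)
  then have "?Q (nat (pairing v v))" using pairing_self_pos[of v] by auto
  then obtain d where d: "?Q d" and least: "\<And>k. ?Q k \<Longrightarrow> d \<le> k"
    using ex_has_least_nat[of ?Q _ "\<lambda>k. k"] by blast
  obtain c where c: "pairing c v = int d" using d by blast
  have dvd: "int d dvd v $ i" for i
  proof (rule ccontr)
    assume "\<not> int d dvd v $ i"
    then have "v $ i mod int d \<noteq> 0" by (simp add: mod_eq_0_iff_dvd)
    moreover have "0 \<le> v $ i mod int d" using d by (intro pos_mod_sign) simp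
    ultimately have pos: "0 < v $ i mod int d" by simp
    have "pairing (axis i 1) v = (\<Sum>j\<in>UNIV. if j = i then v $ j else 0)"
      unfolding pairing_def by (intro sum.cong) (auto simp: axis_def)
    then have "pairing (axis i 1) v = v $ i" by simp
    then have "pairing (axis i 1 - (v $ i div int d) *s c) v = v $ i mod int d"
      by (simp add: pairing_linear c minus_div_mult_eq_mod)
    then have "?Q (nat (v $ i mod int d))" using pos by auto
    then have "d \<le> nat (v $ i mod int d)" by (rule least)
    moreover have "v $ i mod int d < int d" using d by simp
    ultimately show False using pos by linarith
  qed
  have "v = int d *s (\<chi> i. v $ i div int d)" using dvd by (simp add: vec_eq_iff)
  then have "\<bar>int d\<bar> = 1" using assms unfolding primitive_vector_def by blast
  then show ?thesis using c that by simp
qed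

lemma root_derivation_single_eq_0_iff:
  "root_derivation v e (Poly_Mapping.single m (1::'k::field_char_0)) = 0 \<longleftrightarrow> pairing m v = 0"
proof
  assume "root_derivation v e (Poly_Mapping.single m (1::'k)) = 0"
  then have "Poly_Mapping.lookup (root_derivation v e (Poly_Mapping.single m (1::'k))) (m + e) = 0"
    by simp
  then show "pairing m v = 0" by (simp add: lookup_root_derivation)
qed (simp add: root_derivation_single)

context ray_system
begin

text \<open>
  Two ray vectors need not extend to a lattice basis, so a form that is \<open>-1\<close> on \<open>r\<close> and \<open>0\<close> on \<open>v\<close>
  is not available in general. Here \<open>e\<close> provides it: it is \<open>-1\<close> on \<open>v\<close> and \<open>0\<close> on \<open>r\<close>, so the value on
  \<open>v\<close> of any form can be corrected by a multiple of \<open>e\<close>. A multiple of the form exposing the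
  pair makes the result nonnegative on the other rays.
\<close>
lemma exposed_pair_root:
  assumes root: "is_root v e" and r: "r \<in> R - {v}" "primitive_vector r"
    and er: "pairing e r = 0" and exposed: "exposed_pair R v r"
  obtains e' where "is_root r e'" and "pairing e' v = 0"
proof -
  have ev: "pairing e v = -1" and v: "v \<in> R" using root by (simp_all add: is_root_def)
  obtain u where u: "pairing u v = 0" "pairing u r = 0" "\<forall>s\<in>R - {v, r}. 0 < pairing u s"
    using exposed by (auto simp: exposed_pair_def)
  obtain c where c: "pairing c r = 1" using primitive_vector_pairing_one[OF r(2)] by blast
  \<comment> \<open>The multiple of \<open>e\<close> cancels the value on \<open>v\<close> and does not affect the one on \<open>r\<close>.\<close>
  define e0 where "e0 = - (c + pairing c v *s e)"
  have e0: "pairing e0 r = -1" "pairing e0 v = 0"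
    by (simp_all add: e0_def pairing_linear c er ev)
  have "finite (R - {v, r})" using finite_R by simp
  then obtain k where k: "\<forall>s\<in>R - {v, r}. 0 < k * pairing u s + pairing e0 s"
    using finite_int_mult_dominates[of "R - {v, r}" "pairing u" "pairing e0"] u(3) by blast
  define e' where "e' = k *s u + e0"
  have e': "pairing e' s = k * pairing u s + pairing e0 s" for s by (simp add: e'_def pairing_linear)
  have "0 \<le> pairing e' s" if s: "s \<in> R - {r}" for s
  proof (cases "s = v")
    case False
    then have "s \<in> R - {v, r}" using s by blast
    then show ?thesis using k by (simp add: e' less_imp_le)
  qed (simp add: e' u e0)
  then have "is_root r e'" using r(1) by (simp add: is_root_def e' u e0)
  moreover have "pairing e' v = 0" by (simp add: e' u e0)
  ultimately show ?thesis using that by blast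
qed

lemma root_derivation_nonzero:
  assumes "is_root v e"
  shows "nonzero_on weight_algebra (root_derivation v e :: (int ^ 'n \<Rightarrow>\<^sub>0 'k::field_char_0) \<Rightarrow> _)"
proof -
  have v: "v \<in> R" using assms by (simp add: is_root_def)
  obtain p where p: "\<And>s. s \<in> R \<Longrightarrow> 0 < pairing p s" using positive_form by blast
  have "p \<in> weights" using p by (simp add: weights_def less_imp_le)
  moreover have "root_derivation v e (Poly_Mapping.single p (1::'k)) \<noteq> 0"
    using p[OF v] by (simp add: root_derivation_single_eq_0_iff)
  ultimately show ?thesis unfolding nonzero_on_def using weight_algebra_single by blast
qed

text \<open>
  A weight on the facet of \<open>r\<close> that is positive on \<open>v\<close> separates the kernels.
\<close>
lemma root_derivations_inequivalent:
  assumes "v \<in> R" and "r \<in> R - {v}"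
  shows "\<not> equivalent_on weight_algebra (root_derivation r e' :: (int ^ 'n \<Rightarrow>\<^sub>0 'k::field_char_0) \<Rightarrow> _)
    (root_derivation v e)"
proof
  assume eq: "equivalent_on weight_algebra (root_derivation r e' :: (int ^ 'n \<Rightarrow>\<^sub>0 'k) \<Rightarrow> _)
    (root_derivation v e)"
  obtain u where u: "pairing u r = 0" "\<forall>s\<in>R - {r}. 0 < pairing u s" using facet assms(2) by blast
  have "0 \<le> pairing u s" if "s \<in> R" for s
    using u that by (cases "s = r") (auto simp: less_imp_le)
  then have "u \<in> weights" by (simp add: weights_def)
  then have "Poly_Mapping.single u (1::'k) \<in> kernel_on weight_algebra (root_derivation r e')"
    using u(1) by (simp add: kernel_on_def root_derivation_single_eq_0_iff)
  then have "Poly_Mapping.single u (1::'k) \<in> kernel_on weight_algebra (root_derivation v e)"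
    using eq unfolding equivalent_on_def by simp
  then have "pairing u v = 0" by (simp add: kernel_on_def root_derivation_single_eq_0_iff)
  moreover have "0 < pairing u v" using u(2) assms by blast
  ultimately show False by simp
qed

theorem maximal_root_derivation_iff:
  assumes root: "is_root v e" and prim: "\<And>r. r \<in> R \<Longrightarrow> primitive_vector r"
  shows "maximal_lnd weight_algebra (root_derivation v e :: (int ^ 'n \<Rightarrow>\<^sub>0 'k::field_char_0) \<Rightarrow> _)
    \<longleftrightarrow> (\<forall>r\<in>R - {v}. exposed_pair R v r \<longrightarrow> pairing e r \<noteq> 0)"
proof
  assume max: "maximal_lnd weight_algebra (root_derivation v e :: (int ^ 'n \<Rightarrow>\<^sub>0 'k) \<Rightarrow> _)"
  show "\<forall>r\<in>R - {v}. exposed_pair R v r \<longrightarrow> pairing e r \<noteq> 0"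
  proof (intro ballI impI notI)
    fix r assume r: "r \<in> R - {v}" "exposed_pair R v r" "pairing e r = 0"
    obtain e' where e': "is_root r e'" "pairing e' v = 0"
      using exposed_pair_root[OF root r(1) prim r(3,2)] r(1) by blast
    have "commute_on weight_algebra (root_derivation v e) (root_derivation r e' :: (int ^ 'n \<Rightarrow>\<^sub>0 'k) \<Rightarrow> _)"
      unfolding commute_on_def using root_derivations_commute[OF r(3) e'(2)] by blast
    then have "equivalent_on weight_algebra (root_derivation r e' :: (int ^ 'n \<Rightarrow>\<^sub>0 'k) \<Rightarrow> _)
        (root_derivation v e)"
      using max lnd_root_derivation[OF e'(1)] root_derivation_nonzero[OF e'(1)]
      unfolding maximal_lnd_def by blast
    moreover have "v \<in> R" using root by (simp add: is_root_def)
    ultimately show False using root_derivations_inequivalent r(1) by blast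
  qed
next
  assume "\<forall>r\<in>R - {v}. exposed_pair R v r \<longrightarrow> pairing e r \<noteq> 0"
  then show "maximal_lnd weight_algebra (root_derivation v e :: (int ^ 'n \<Rightarrow>\<^sub>0 'k) \<Rightarrow> _)"
    unfolding maximal_lnd_def
    using lnd_root_derivation[OF root] root_derivation_nonzero[OF root]
      commuting_inequivalent_lnd[OF root] by metis
qed

end

theorem proposition6p5:
  fixes \<sigma> \<rho> :: "(rat ^ 'n) set" and e :: "int ^ 'n"
  assumes "polyhedral_cone \<sigma>" and "pointed_cone \<sigma>"
    and "\<rho> \<in> extremal_rays \<sigma>" and "demazure_root \<sigma> \<rho> e"
  shows "maximal_lnd (coord_ring \<sigma> :: (int ^ 'n \<Rightarrow>\<^sub>0 'k::{alg_closed_field, field_char_0}) set)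
           (demazure_lnd \<rho> e) \<longleftrightarrow>
         (\<forall>\<rho>'\<in>adjacent_rays \<sigma> \<rho>. pairing e (ray_vector \<rho>') \<noteq> 0)"
proof -
  note cone = assms(1,2)
  interpret ray_system "ray_vectors \<sigma>"
    by (rule ray_system.intro[OF finite_ray_vectors[OF cone] ray_vectors_nonzero[OF cone] ray_facet[OF cone]])
  have ring: "(coord_ring \<sigma> :: (int ^ 'n \<Rightarrow>\<^sub>0 'k) set) = weight_algebra"
    by (auto simp: coord_ring_def weight_algebra_def weights_def rat_vec_mem_dual_cone_iff[OF cone])
  have inj: "ray_vector \<rho>' = ray_vector \<rho> \<longleftrightarrow> \<rho>' = \<rho>" if "\<rho>' \<in> extremal_rays \<sigma>" for \<rho>'
    using inj_onD[OF inj_on_ray_vector[OF cone] _ that assms(3)] by blast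
  have root: "is_root (ray_vector \<rho>) e"
    unfolding is_root_def using assms(4) inj by (auto simp: demazure_root_def ray_vectors_def)
  have prim: "primitive_vector r" if "r \<in> ray_vectors \<sigma>" for r
    using that ray_vector_props(1)[OF cone] by (auto simp: ray_vectors_def)
  have "maximal_lnd (coord_ring \<sigma> :: (int ^ 'n \<Rightarrow>\<^sub>0 'k) set) (demazure_lnd \<rho> e) \<longleftrightarrow>
      (\<forall>r\<in>ray_vectors \<sigma> - {ray_vector \<rho>}.
        exposed_pair (ray_vectors \<sigma>) (ray_vector \<rho>) r \<longrightarrow> pairing e r \<noteq> 0)"
    unfolding ring demazure_lnd_eq by (rule maximal_root_derivation_iff[OF root prim])
  also have "\<dots> \<longleftrightarrow> (\<forall>\<rho>'\<in>extremal_rays \<sigma> - {\<rho>}.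
      exposed_pair (ray_vectors \<sigma>) (ray_vector \<rho>) (ray_vector \<rho>') \<longrightarrow> pairing e (ray_vector \<rho>') \<noteq> 0)"
    using inj by (auto simp: ray_vectors_def)
  also have "\<dots> \<longleftrightarrow> (\<forall>\<rho>'\<in>adjacent_rays \<sigma> \<rho>. pairing e (ray_vector \<rho>') \<noteq> 0)"
  proof -
    have "\<rho>' \<in> adjacent_rays \<sigma> \<rho> \<longleftrightarrow> \<rho>' \<in> extremal_rays \<sigma> - {\<rho>} \<and>
        exposed_pair (ray_vectors \<sigma>) (ray_vector \<rho>) (ray_vector \<rho>')" for \<rho>'
      using exposed_pair_of_adjacent[OF cone assms(3), of \<rho>'] adjacent_of_exposed_pair[OF cone assms(3), of \<rho>']
      by (auto simp: adjacent_rays_def)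
    then show ?thesis by blast
  qed
  finally show ?thesis .
qed

end
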